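(* Let $\alpha$ be the smallest real root of $z^8-4z^7-17z^6+8z^5+49z^4+8z^3-17z^2-4z+1$. Then the B-Z constant of the family $\mathcal{C}_4=\{C_n^4 : n\ge 9\}$ of fourth powers of cycles exists and equals $$BZ(\mathcal{C}_4)=\lim_{n\to\infty}\frac{\sum_{T\in\mathcal{T}(C_n^4)}|\mathcal{L}(T)|}{n\cdot\tau(C_n^4)}=\frac{1}{2025}\left(-216\alpha^7-2144\alpha^6+16344\alpha^5+41056\alpha^4-17064\alpha^3-87936\alpha^2-25304\alpha+6944\right).$$
   Context: All graphs are finite and simple. $C_n$ is the cycle graph on $n$ vertices. For a graph $G$ and $k\ge1$, the $k$-th power $G^k$ has $V(G^k)=V(G)$, and $uv$ is an edge iff the distance between $u$ and $v$ in $G$ is at least $1$ and at most $k$. $\mathcal{T}(G)$ is the set of labeled spanning trees of $G$, $\tau(G)=|\mathcal{T}(G)|$, and $\mathcal{L}(T)$ is the set of leaves (vertices of degree exactly $1$ in $T$) of a tree $T$. For a graph family $\mathcal{G}$ indexed by number of vertices, with $G_n$ the member on $n$ vertices, the B-Z constant is $BZ(\mathcal{G}):=\lim_{n\to\infty}\frac{\sum_{T\in\mathcal{T}(G_n)}|\mathcal{L}(T)|}{n\,\tau(G_n)}$ whenever the limit exists. *)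

theory Defs
  imports Complex_Main "HOL-Library.Extended_Nat"
begin

text \<open>
  Undirected graphs, with edges represented as two-element sets of vertices. A labeled spanning
  tree is a subgraph, so that distinct edge sets give distinct trees (no quotient by isomorphism).
\<close>

record 'a graph =
  verts :: "'a set"
  edges :: "'a set set"

definition simple_graph :: "'a graph \<Rightarrow> bool" where
  "simple_graph G \<longleftrightarrow> finite (verts G) \<and> (\<forall>e\<in>edges G. e \<subseteq> verts G \<and> card e = 2)"

definition walk :: "'a graph \<Rightarrow> 'a list \<Rightarrow> bool" where
  "walk G p \<longleftrightarrow> p \<noteq> [] \<and> set p \<subseteq> verts G \<and> successively (\<lambda>u v. {u, v} \<in> edges G) p"

text \<open>The distance is \<open>\<infinity>\<close> (the infimum of the empty set) if no walk joins the two vertices.\<close>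

definition graph_dist :: "'a graph \<Rightarrow> 'a \<Rightarrow> 'a \<Rightarrow> enat" where
  "graph_dist G u v = (INF p\<in>{p. walk G p \<and> hd p = u \<and> last p = v}. enat (length p - 1))"

definition graph_power :: "'a graph \<Rightarrow> nat \<Rightarrow> 'a graph" where
  "graph_power G k =
     \<lparr>verts = verts G,
      edges = {{u, v} |u v. u \<in> verts G \<and> v \<in> verts G \<and>
                             1 \<le> graph_dist G u v \<and> graph_dist G u v \<le> enat k}\<rparr>"

text \<open>This is the cycle \<open>C\<^sub>n\<close> for \<open>n \<ge> 3\<close>; smaller \<open>n\<close> are degenerate.\<close>

definition cycle_graph :: "nat \<Rightarrow> nat graph" where
  "cycle_graph n = \<lparr>verts = {..<n}, edges = {{i, (i + 1) mod n} |i. i < n}\<rparr>"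

definition connected_graph :: "'a graph \<Rightarrow> bool" where
  "connected_graph G \<longleftrightarrow> verts G \<noteq> {} \<and>
     (\<forall>u\<in>verts G. \<forall>v\<in>verts G. \<exists>p. walk G p \<and> hd p = u \<and> last p = v)"

definition is_cycle :: "'a graph \<Rightarrow> 'a list \<Rightarrow> bool" where
  "is_cycle G p \<longleftrightarrow> walk G p \<and> distinct p \<and> length p \<ge> 3 \<and> {last p, hd p} \<in> edges G"

definition tree :: "'a graph \<Rightarrow> bool" where
  "tree T \<longleftrightarrow> simple_graph T \<and> connected_graph T \<and> (\<nexists>p. is_cycle T p)"

definition spanning_trees :: "'a graph \<Rightarrow> 'a graph set" where
  "spanning_trees G = {T. verts T = verts G \<and> edges T \<subseteq> edges G \<and> tree T}"

definition \<tau> :: "'a graph \<Rightarrow> nat" where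
  "\<tau> G = card (spanning_trees G)"

definition degree :: "'a graph \<Rightarrow> 'a \<Rightarrow> nat" where
  "degree G v = card {e \<in> edges G. v \<in> e}"

definition leaves :: "'a graph \<Rightarrow> 'a set" where
  "leaves T = {v \<in> verts T. degree T v = 1}"

text \<open>
  A family \<open>G\<close> is indexed by the number of vertices, \<open>G n\<close> being its member on \<open>n\<close> vertices;
  the values at finitely many \<open>n\<close> (where the family may have no member) do not affect the limit.
  The constant \<open>BZ G\<close> is meaningful only if \<open>convergent (BZ_ratio G)\<close>.
\<close>

definition BZ_ratio :: "(nat \<Rightarrow> 'a graph) \<Rightarrow> nat \<Rightarrow> real" where
  "BZ_ratio G n =
     real (\<Sum>T\<in>spanning_trees (G n). card (leaves T)) / (real n * real (\<tau> (G n)))"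

definition BZ :: "(nat \<Rightarrow> 'a graph) \<Rightarrow> real" where
  "BZ G = lim (BZ_ratio G)"

lemma simple_graph_cycle_graph:
  assumes "n \<ge> 3"
  shows "simple_graph (cycle_graph n)"
proof -
  have "i \<noteq> (i + 1) mod n" if "i < n" for i
    using assms that by (cases "i + 1 = n") auto
  with assms show ?thesis
    by (auto simp: simple_graph_def cycle_graph_def card_2_iff)
qed

lemma simple_graph_graph_power:
  assumes "finite (verts G)"
  shows "simple_graph (graph_power G k)"
proof -
  have "graph_dist G u u = 0" if "u \<in> verts G" for u
  proof -
    have "walk G [u]" using that by (simp add: walk_def)
    then have "graph_dist G u u \<le> enat (length [u] - 1)"
      unfolding graph_dist_def by (intro INF_lower) simp
    then show ?thesis by (simp add: zero_enat_def[symmetric])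
  qed
  then have "card {u, v} = 2" if "u \<in> verts G" "1 \<le> graph_dist G u v" for u v
    using that by (cases "u = v") auto
  with assms show ?thesis
    by (auto simp: simple_graph_def graph_power_def)
qed

lemma finite_spanning_trees:
  assumes "simple_graph G"
  shows "finite (spanning_trees G)"
proof -
  have "edges G \<subseteq> Pow (verts G)" "finite (verts G)"
    using assms by (auto simp: simple_graph_def)
  then have "finite (edges G)" by (meson finite_Pow_iff finite_subset)
  moreover have "spanning_trees G \<subseteq> (\<lambda>E. \<lparr>verts = verts G, edges = E\<rparr>) ` Pow (edges G)"
  proof
    fix T assume "T \<in> spanning_trees G"
    then have "T = \<lparr>verts = verts G, edges = edges T\<rparr>" "edges T \<in> Pow (edges G)"
      by (auto simp: spanning_trees_def)
    then show "T \<in> (\<lambda>E. \<lparr>verts = verts G, edges = E\<rparr>) ` Pow (edges G)" by blast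
  qed
  ultimately show ?thesis by (meson finite_Pow_iff finite_imageI finite_subset)
qed

end

theory Submission
  imports Defs "Jordan_Normal_Form.Determinant"
begin

text \<open>
  Summing the number of leaves over all spanning trees counts the pairs of a vertex \<open>v\<close> and a spanning
  tree in which \<open>v\<close> has degree 1. For fixed \<open>v\<close>, give weight \<open>t\<close> to the edges at \<open>v\<close>. By the weighted
  matrix-tree theorem (\<open>matrix_tree\<close>) the sum of \<open>t ^ deg v\<close> over all spanning trees is the determinant
  of the Laplacian \<open>L_t\<close> grounded at \<open>v\<close>, and the trees with leaf \<open>v\<close> are counted by its coefficient of \<open>t\<close>.

  In the fourth power of a cycle only eight diagonal entries of \<open>L_t\<close> depend on \<open>t\<close>, so \<open>det L_t / det L_1\<close>
  is the determinant of an \<open>8 \<times> 8\<close> matrix built from the Green function of \<open>L_1\<close>. The reflection of the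
  cycle splits it into two \<open>4 \<times> 4\<close> determinants, and one of them has the factor \<open>t\<close>. Therefore the ratio
  in question equals, for each \<open>n \<ge> 9\<close>, a fixed polynomial in the values at \<open>0, \<dots>, 8\<close> of the potential
  kernel of the Laplacian (\<open>cycle_green.BZ_ratio_eq\<close>), and it remains to find the limits of these values.

  Let \<open>S\<close> be the shift on the cycle. The Laplacian is \<open>(2 - S - 1/S) P\<close>, where \<open>P\<close> is a difference
  operator with positive symbol. So the second difference of the potential kernel is, up to a term of
  order \<open>1/n\<close>, the Green function of \<open>P\<close>, called the curvature. Factor \<open>s P = q(S) q(1/S)\<close> with
  \<open>q z = z^3 + p z^2 + r z + s\<close> having all its zeros in the unit disc. Then \<open>q(1/S)\<close> applied to the curvature
  satisfies a stable recurrence away from 0 and decays around the cycle, which gives a nonsingular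
  linear system for the limits (\<open>spectral_factor.curvature_tendsto\<close>).

  The coefficient \<open>s\<close> is the number \<open>\<alpha>\<close>: as \<open>-s\<close> is the product of three zeros, one from each reciprocal
  pair of zeros of the symbol, it is an algebraic number of degree at most \<open>2^3\<close>. The coefficients \<open>p\<close>, \<open>r\<close>,
  the limits of the potential kernel and the two determinants are rational polynomials in \<open>\<alpha>\<close>, and the
  claimed value comes from exact arithmetic with a root of the given polynomial.
\<close>

section \<open>Spanning trees as parent maps\<close>

abbreviation adjacency :: "'a graph \<Rightarrow> ('a \<times> 'a) set" where
  "adjacency G \<equiv> {(x, y). {x, y} \<in> edges G}"

definition neighbours :: "'a graph \<Rightarrow> 'a \<Rightarrow> 'a set" where
  "neighbours G u = {y. {u, y} \<in> edges G}"

text \<open>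
  A rank dropping along \<open>f\<close> says that iterating \<open>f\<close> from any point of \<open>U\<close> leaves \<open>U\<close>; on a
  finite set of non-root vertices this is the absence of directed cycles.
\<close>

definition ranked :: "'a set \<Rightarrow> ('a \<Rightarrow> 'a) \<Rightarrow> bool" where
  "ranked U f \<longleftrightarrow> (\<exists>d :: 'a \<Rightarrow> nat. \<forall>u\<in>U. d (f u) < d u)"

definition parent_graph :: "'a set \<Rightarrow> 'a \<Rightarrow> ('a \<Rightarrow> 'a) \<Rightarrow> 'a graph" where
  "parent_graph V v f = \<lparr>verts = V, edges = {{u, f u} |u. u \<in> V - {v}}\<rparr>"

definition parent_maps :: "'a graph \<Rightarrow> 'a \<Rightarrow> ('a \<Rightarrow> 'a) set" where
  "parent_maps G v = {f \<in> PiE (verts G - {v}) (neighbours G). ranked (verts G - {v}) f}"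

lemma edge_verts:
  assumes "simple_graph G" "{x, y} \<in> edges G"
  shows "x \<in> verts G" "y \<in> verts G" "x \<noteq> y"
  using assms by (auto simp: simple_graph_def card_2_iff)

lemma rtrancl_walk:
  assumes "simple_graph G" "x \<in> verts G" "(x, y) \<in> (adjacency G)\<^sup>*"
  shows "\<exists>p. walk G p \<and> hd p = x \<and> last p = y"
  using assms(3,2)
proof (induction rule: converse_rtrancl_induct)
  case base
  then show ?case by (intro exI[of _ "[y]"]) (simp add: walk_def)
next
  case (step x z)
  then have xz: "{x, z} \<in> edges G" by simp
  with step edge_verts[OF assms(1)] obtain p where p: "walk G p" "hd p = z" "last p = y" by blast
  then obtain ys where "p = z # ys" by (cases p) (auto simp: walk_def)
  with p xz step.prems have "walk G (x # p)" "hd (x # p) = x" "last (x # p) = y"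
    by (auto simp: walk_def)
  then show ?case by blast
qed

lemma distinct_walk:
  assumes "walk G p"
  shows "\<exists>q. walk G q \<and> hd q = hd p \<and> last q = last p \<and> distinct q"
  using assms
proof (induction "length p" arbitrary: p rule: less_induct)
  case less
  show ?case
  proof (cases "distinct p")
    case False
    then obtain xs ys zs y where p: "p = xs @ [y] @ ys @ [y] @ zs"
      using not_distinct_decomp by blast
    let ?q = "xs @ [y] @ zs"
    have "walk G (xs @ (y # ys) @ (y # zs))" using less.prems p by simp
    then have "walk G (xs @ (y # zs))"
      unfolding walk_def successively_append_iff by (simp split: if_splits)
    then have "walk G ?q" by simp
    moreover have "hd ?q = hd p" "last ?q = last p" "length ?q < length p"
      using p by (auto simp: hd_append)
    ultimately show ?thesis using less.hyps by metis
  qed (use less in blast)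
qed

lemma connected_graphI:
  assumes "simple_graph G" "v \<in> verts G" "\<And>u. u \<in> verts G \<Longrightarrow> (u, v) \<in> (adjacency G)\<^sup>*"
  shows "connected_graph G"
proof -
  have sym: "sym ((adjacency G)\<^sup>*)" by (rule sym_rtrancl) (auto simp: sym_def insert_commute)
  have "(x, y) \<in> (adjacency G)\<^sup>*" if "x \<in> verts G" "y \<in> verts G" for x y
    using assms(3)[OF that(1)] symD[OF sym assms(3)[OF that(2)]] by (rule rtrancl_trans)
  then show ?thesis
    unfolding connected_graph_def using rtrancl_walk[OF assms(1)] assms(2) by blast
qed

lemma simple_parent_graph:
  assumes "finite V" "f \<in> (V - {v}) \<rightarrow> V" "ranked (V - {v}) f"
  shows "simple_graph (parent_graph V v f)"
proof -
  have "f u \<noteq> u" if "u \<in> V - {v}" for u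
    using assms(3) that unfolding ranked_def by (metis less_irrefl)
  then have "card {u, f u} = 2" if "u \<in> V - {v}" for u
    using that by (metis card_2_iff)
  then show ?thesis using assms(1,2) by (auto simp: simple_graph_def parent_graph_def)
qed

text \<open>
  Following parents from any vertex ends at the root because the rank drops, and a vertex of
  largest rank on a cycle would have its parent as both of its neighbours on the cycle.
\<close>

lemma tree_parent_graph:
  assumes V: "finite V" "v \<in> V" and f: "f \<in> (V - {v}) \<rightarrow> V" and r: "ranked (V - {v}) f"
  shows "tree (parent_graph V v f)"
proof -
  let ?T = "parent_graph V v f"
  have simple: "simple_graph ?T" by (rule simple_parent_graph[OF V(1) f r])
  obtain d :: "'a \<Rightarrow> nat" where d: "\<And>u. u \<in> V - {v} \<Longrightarrow> d (f u) < d u"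
    using r unfolding ranked_def by blast
  have "(u, v) \<in> (adjacency ?T)\<^sup>*" if "u \<in> V" for u
    using that
  proof (induction "d u" arbitrary: u rule: less_induct)
    case less
    show ?case
    proof (cases "u = v")
      case False
      then have u: "u \<in> V - {v}" using less.prems by simp
      then have "(f u, v) \<in> (adjacency ?T)\<^sup>*" using less.hyps[OF d[OF u]] f by auto
      moreover have "(u, f u) \<in> adjacency ?T" using u by (auto simp: parent_graph_def)
      ultimately show ?thesis by (rule converse_rtrancl_into_rtrancl[rotated])
    qed simp
  qed
  then have conn: "connected_graph ?T"
    using connected_graphI[OF simple, of v] V by (simp add: parent_graph_def)
  have edge: "y = f x \<and> x \<in> V - {v} \<or> x = f y \<and> y \<in> V - {v}" if "{x, y} \<in> edges ?T" for x y
    using that by (auto simp: parent_graph_def doubleton_eq_iff)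
  have "\<not> is_cycle ?T p" for p
  proof
    assume cyc: "is_cycle ?T p"
    let ?n = "length p"
    have n: "?n \<ge> 3" and dist: "distinct p" using cyc by (auto simp: is_cycle_def)
    have cons: "{p ! i, p ! (Suc i mod ?n)} \<in> edges ?T" if "i < ?n" for i
    proof (cases "Suc i = ?n")
      case True
      then have "i = ?n - 1" by simp
      moreover have "p \<noteq> []" using n by auto
      ultimately have "p ! i = last p" "p ! (Suc i mod ?n) = hd p"
        using True by (simp_all add: last_conv_nth hd_conv_nth)
      then show ?thesis using cyc by (simp add: is_cycle_def)
    next
      case False
      then show ?thesis using cyc that successively_nth
        by (fastforce simp: is_cycle_def walk_def)
    qed
    obtain i where i: "i < ?n" and max: "\<And>j. j < ?n \<Longrightarrow> d (p ! j) \<le> d (p ! i)"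
    proof -
      have "finite (d ` set p)" "d ` set p \<noteq> {}" using n by auto
      then have "Max (d ` set p) \<in> d ` set p" by (rule Max_in)
      then obtain x where x: "x \<in> set p" "d x = Max (d ` set p)" by auto
      then obtain i where i: "i < ?n" "p ! i = x" by (auto simp: in_set_conv_nth)
      have "d (p ! j) \<le> d (p ! i)" if "j < ?n" for j
        unfolding i(2) x(2) using that by (intro Max_ge) auto
      then show ?thesis using that i(1) by blast
    qed
    have par: "p ! j = f (p ! i)" if "j < ?n" "{p ! i, p ! j} \<in> edges ?T" for j
      using edge[OF that(2)] d[of "p ! j"] max[OF that(1)] by auto
    define j where "j = Suc i mod ?n"
    define k where "k = (if i = 0 then ?n - 1 else i - 1)"
    have n0: "0 < ?n" using n by linarith
    have jk: "j < ?n" "k < ?n" "Suc k mod ?n = i"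
      using i n mod_less_divisor[OF n0, of "Suc i"] by (auto simp: j_def k_def)
    have "p ! j = f (p ! i)" using par[OF jk(1)] cons[OF i] by (simp only: j_def)
    moreover have "p ! k = f (p ! i)"
      using par[OF jk(2)] cons[OF jk(2)] by (simp only: jk(3) insert_commute)
    ultimately have "j = k" using nth_eq_iff_index_eq[OF dist jk(1,2)] by simp
    then show False using n i by (cases "Suc i = ?n") (auto simp: j_def k_def split: if_splits)
  qed
  then show ?thesis using simple conn by (simp add: tree_def)
qed

text \<open>
  An edge \<open>{u, f u}\<close> of the common graph is \<open>{u, g u}\<close> or comes from \<open>g (f u) = u\<close>. Induction on the
  rank of \<open>f\<close> excludes the second case.
\<close>

lemma parent_graph_inject:
  assumes f: "f \<in> extensional (V - {v})" "ranked (V - {v}) f"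
    and g: "g \<in> extensional (V - {v})"
    and eq: "parent_graph V v f = parent_graph V v g"
  shows "f = g"
proof (rule extensionalityI[OF f(1) g])
  obtain d :: "'a \<Rightarrow> nat" where d: "\<And>u. u \<in> V - {v} \<Longrightarrow> d (f u) < d u"
    using f(2) unfolding ranked_def by blast
  show "f u = g u" if "u \<in> V - {v}" for u
    using that
  proof (induction "d u" arbitrary: u rule: less_induct)
    case less
    have "{u, f u} \<in> edges (parent_graph V v g)"
      unfolding eq[symmetric] using less.prems by (auto simp: parent_graph_def)
    then have "f u = g u \<or> f u \<in> V - {v} \<and> g (f u) = u"
      by (auto simp: parent_graph_def doubleton_eq_iff)
    then show ?case
    proof
      assume fu: "f u \<in> V - {v} \<and> g (f u) = u"
      \<comment> \<open>Otherwise \<open>f\<close> and \<open>g\<close> would agree at \<open>f u\<close>, so \<open>f\<close> would swap \<open>u\<close> and \<open>f u\<close>.\<close>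
      then have "f (f u) = u" using less.hyps[of "f u"] d[OF less.prems] by auto
      then show ?thesis using d[OF less.prems] d[of "f u"] fu by auto
    qed
  qed
qed

text \<open>
  Orient every edge towards the root by choosing a neighbour on a shortest walk to it. The chosen
  edges already connect the graph, so a further edge would close a cycle.
\<close>

lemma tree_is_parent_graph:
  assumes T: "tree T" and v: "v \<in> verts T"
  shows "\<exists>f \<in> PiE (verts T - {v}) (neighbours T).
           ranked (verts T - {v}) f \<and> parent_graph (verts T) v f = T"
proof -
  let ?V = "verts T"
  have simple: "simple_graph T" and conn: "connected_graph T" using T by (auto simp: tree_def)
  define d where "d u = (LEAST k. \<exists>p. walk T p \<and> hd p = u \<and> last p = v \<and> length p = k)" for u
  have step: "\<exists>y. {u, y} \<in> edges T \<and> d y < d u" if u: "u \<in> ?V - {v}" for u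
  proof -
    have "\<exists>k p. walk T p \<and> hd p = u \<and> last p = v \<and> length p = k"
      using conn u v unfolding connected_graph_def by blast
    then have "\<exists>p. walk T p \<and> hd p = u \<and> last p = v \<and> length p = d u"
      unfolding d_def by (rule LeastI_ex)
    then obtain p where p: "walk T p" "hd p = u" "last p = v" "length p = d u" by blast
    then obtain y ys where py: "p = u # y # ys"
      using u by (cases p rule: remdups_adj.cases) (auto simp: walk_def)
    then have "walk T (y # ys)" "last (y # ys) = v" and uy: "{u, y} \<in> edges T"
      using p by (auto simp: walk_def)
    then have "\<exists>q. walk T q \<and> hd q = y \<and> last q = v \<and> length q = length (y # ys)"
      by (intro exI[of _ "y # ys"]) simp
    then have "d y \<le> length (y # ys)" unfolding d_def by (rule Least_le)
    also have "\<dots> < d u" using p(4) py by simp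
    finally show ?thesis using uy by blast
  qed
  define f where "f = restrict (\<lambda>u. SOME y. {u, y} \<in> edges T \<and> d y < d u) (?V - {v})"
  have f: "{u, f u} \<in> edges T" "d (f u) < d u" if "u \<in> ?V - {v}" for u
    using someI_ex[OF step[OF that]] that by (simp_all add: f_def)
  let ?S = "parent_graph ?V v f"
  have PiE: "f \<in> PiE (?V - {v}) (neighbours T)"
    using f(1) by (auto simp: neighbours_def f_def)
  have r: "ranked (?V - {v}) f" unfolding ranked_def using f(2) by blast
  have fV: "f \<in> (?V - {v}) \<rightarrow> ?V" using edge_verts(2)[OF simple f(1)] by blast
  have finV: "finite ?V" using simple by (simp add: simple_graph_def)
  have sub: "edges ?S \<subseteq> edges T" using f(1) by (auto simp: parent_graph_def)
  have tS: "tree ?S" by (rule tree_parent_graph[OF finV v fV r])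
  have "edges T \<subseteq> edges ?S"
  proof
    fix e assume e: "e \<in> edges T"
    then obtain a b where ab: "e = {a, b}" "a \<noteq> b" "a \<in> ?V" "b \<in> ?V"
      using simple by (auto simp: simple_graph_def card_2_iff)
    show "e \<in> edges ?S"
    proof (rule ccontr)
      assume no: "e \<notin> edges ?S"
      have "connected_graph ?S" using tS by (simp add: tree_def)
      then obtain p where "walk ?S p" "hd p = a" "last p = b"
        using ab by (auto simp: connected_graph_def parent_graph_def)
      then obtain q where q: "walk ?S q" "hd q = a" "last q = b" "distinct q"
        using distinct_walk by metis
      have "length q \<ge> 3"
      proof (rule ccontr)
        assume "\<not> ?thesis"
        then consider "q = []" | x where "q = [x]" | x y where "q = [x, y]"
          by (cases q rule: remdups_adj.cases) (auto simp: Suc_le_eq numeral_3_eq_3)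
        then show False
        proof cases
          case 1
          then show False using q(1) by (simp add: walk_def)
        next
          case 2
          then show False using q(2,3) ab(2) by simp
        next
          case 3
          then show False using q(1-3) no ab(1) by (simp add: walk_def)
        qed
      qed
      moreover have "walk T q"
        using q(1) sub successively_mono[of "\<lambda>u v. {u, v} \<in> edges ?S" q "\<lambda>u v. {u, v} \<in> edges T"]
        by (auto simp: walk_def parent_graph_def)
      ultimately have "is_cycle T q"
        using q e ab by (auto simp: is_cycle_def insert_commute)
      then show False using T by (auto simp: tree_def)
    qed
  qed
  then have "?S = T" using sub by (auto simp: parent_graph_def)
  with PiE r show ?thesis by blast
qed

text \<open>
  The tree with its edges oriented towards \<open>v\<close> is a ranked parent map, so spanning trees can be
  counted as ranked maps, which is what the expansion of a determinant produces.
\<close>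

lemma bij_betw_parent_graph:
  assumes G: "simple_graph G" and v: "v \<in> verts G"
  shows "bij_betw (parent_graph (verts G) v) (parent_maps G v) (spanning_trees G)"
proof (rule bij_betw_imageI)
  show "inj_on (parent_graph (verts G) v) (parent_maps G v)"
  proof (rule inj_onI)
    fix f g assume "f \<in> parent_maps G v" "g \<in> parent_maps G v"
      and eq: "parent_graph (verts G) v f = parent_graph (verts G) v g"
    then have "f \<in> extensional (verts G - {v})" "ranked (verts G - {v}) f"
      "g \<in> extensional (verts G - {v})" by (simp_all add: parent_maps_def PiE_def)
    then show "f = g" using eq by (rule parent_graph_inject)
  qed
  show "parent_graph (verts G) v ` parent_maps G v = spanning_trees G"
  proof (intro equalityI subsetI)
    fix T assume "T \<in> parent_graph (verts G) v ` parent_maps G v"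
    then obtain f where f: "f \<in> PiE (verts G - {v}) (neighbours G)" "ranked (verts G - {v}) f"
      and T: "T = parent_graph (verts G) v f" by (auto simp: parent_maps_def)
    have "{u, f u} \<in> edges G" if "u \<in> verts G - {v}" for u
      using PiE_mem[OF f(1) that] by (simp add: neighbours_def)
    moreover from this have "f \<in> (verts G - {v}) \<rightarrow> verts G"
      using edge_verts(2)[OF G] by blast
    then have "tree T" unfolding T
      using tree_parent_graph[of "verts G" v f] f(2) v G by (simp add: simple_graph_def)
    ultimately show "T \<in> spanning_trees G"
      by (auto simp: spanning_trees_def T parent_graph_def)
  next
    fix T assume "T \<in> spanning_trees G"
    then have T: "tree T" "verts T = verts G" "edges T \<subseteq> edges G"
      by (auto simp: spanning_trees_def)
    obtain f where f: "f \<in> PiE (verts G - {v}) (neighbours T)"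
      "ranked (verts G - {v}) f" "parent_graph (verts G) v f = T"
      using tree_is_parent_graph[OF T(1), of v, unfolded T(2), OF v] by blast
    have "f \<in> PiE (verts G - {v}) (neighbours G)"
      using f(1) T(3) by (auto simp: neighbours_def PiE_def Pi_def)
    with f show "T \<in> parent_graph (verts G) v ` parent_maps G v"
      unfolding parent_maps_def by blast
  qed
qed

lemma degree_parent_graph:
  "Defs.degree (parent_graph V v f) v = card {u \<in> V - {v}. f u = v}"
proof -
  let ?C = "{u \<in> V - {v}. f u = v}"
  have "e \<in> (\<lambda>u. {u, v}) ` ?C" if "e = {u, f u}" "u \<in> V - {v}" "v \<in> e" for e u
    using that by (intro image_eqI[of _ _ u]) auto
  then have "{e \<in> edges (parent_graph V v f). v \<in> e} \<subseteq> (\<lambda>u. {u, v}) ` ?C"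
    unfolding parent_graph_def graph.simps by blast
  moreover have "(\<lambda>u. {u, v}) ` ?C \<subseteq> {e \<in> edges (parent_graph V v f). v \<in> e}"
    unfolding parent_graph_def graph.simps by blast
  ultimately have "{e \<in> edges (parent_graph V v f). v \<in> e} = (\<lambda>u. {u, v}) ` ?C"
    by (rule equalityI)
  moreover have "inj_on (\<lambda>u. {u, v}) ?C" by (rule inj_onI) (simp add: doubleton_eq_iff)
  ultimately show ?thesis unfolding Defs.degree_def by (simp only: card_image)
qed

section \<open>The weighted matrix-tree theorem\<close>

text \<open>Only the identity permutation can follow parents: a permutation preserves the total rank.\<close>

lemma det_ranked:
  fixes F :: "nat \<Rightarrow> nat \<Rightarrow> bool" and d :: "nat \<Rightarrow> nat"
  assumes d: "\<And>i j. i < m \<Longrightarrow> j < m \<Longrightarrow> F i j \<Longrightarrow> d j < d i"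
  shows "det (mat m m (\<lambda>(i, j). of_bool (i = j) - of_bool (F i j) :: 'a :: idom)) = 1"
proof -
  let ?A = "mat m m (\<lambda>(i, j). of_bool (i = j) - of_bool (F i j) :: 'a)"
  have irr: "\<not> F i i" if "i < m" for i using d[OF that that] by auto
  have "signof p * (\<Prod>i = 0..<m. ?A $$ (i, p i)) = 0" if p: "p permutes {0..<m}" "p \<noteq> id" for p
  proof (rule ccontr)
    assume nz: "\<not> ?thesis"
    have lt: "p i < m" if "i < m" for i using permutes_in_image[OF p(1)] that by auto
    have "?A $$ (i, p i) \<noteq> 0" if "i < m" for i using nz that by auto
    then have step: "p i = i \<or> F i (p i)" if "i < m" for i
      using that lt[OF that] by (fastforce split: if_splits)
    obtain k where "p k \<noteq> k" using p(2) by (auto simp: fun_eq_iff)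
    then have k: "k < m" using p(1) by (auto simp: permutes_def)
    have "(\<Sum>i<m. d (p i)) < (\<Sum>i<m. d i)"
    proof (rule sum_strict_mono_ex1)
      have "d (p k) < d k" using step[OF k] \<open>p k \<noteq> k\<close> d[OF k lt[OF k]] by auto
      then show "\<exists>i\<in>{..<m}. d (p i) < d i" using k by blast
      show "\<forall>i\<in>{..<m}. d (p i) \<le> d i"
      proof
        fix i assume "i \<in> {..<m}"
        then have i: "i < m" by simp
        show "d (p i) \<le> d i" using step[OF i] d[OF i lt[OF i]] by (auto intro: less_imp_le)
      qed
    qed simp
    moreover have "(\<Sum>i<m. d (p i)) = (\<Sum>i<m. d i)"
      using sum.permute[OF p(1), of d] by (simp add: comp_def atLeast0LessThan)
    ultimately show False by simp
  qed
  then have "det ?A = (\<Sum>p\<in>{id}. signof p * (\<Prod>i = 0..<m. ?A $$ (i, p i)))"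
    unfolding det_def'[OF mat_carrier]
    by (intro sum.mono_neutral_right) (auto simp: permutes_id finite_permutations)
  then show ?thesis by (simp add: irr)
qed

text \<open>
  The indicator vector of the vertices whose parent chain misses the root lies in the kernel: a vertex
  reaches the root iff its parent does.
\<close>

lemma det_unranked:
  assumes e: "bij_betw e {..<m} U" and v: "v \<notin> U" and f: "f \<in> U \<rightarrow> insert v U"
    and r: "\<not> ranked U f"
  shows "det (mat m m (\<lambda>(i, j). of_bool (i = j) - of_bool (f (e i) = e j) :: real)) = 0"
proof -
  let ?A = "mat m m (\<lambda>(i, j). of_bool (i = j) - of_bool (f (e i) = e j) :: real)"
  define g where "g u = (if u = v then v else f u)" for u
  define reach where "reach u \<longleftrightarrow> (\<exists>k. (g ^^ k) u = v)" for u
  have reach_g: "reach u \<longleftrightarrow> reach (f u)" if "u \<in> U" for u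
  proof
    have u: "u \<noteq> v" "g u = f u" using that v by (auto simp: g_def)
    have Suc: "(g ^^ Suc k) u = (g ^^ k) (f u)" for k
      by (simp only: funpow_Suc_right comp_apply u)
    show "reach (f u)" if ru: "reach u"
    proof -
      obtain k where k: "(g ^^ k) u = v" using ru unfolding reach_def by blast
      with u obtain l where "k = Suc l" by (cases k) simp_all
      with k Suc have "(g ^^ l) (f u) = v" by (simp only:)
      then show ?thesis unfolding reach_def by blast
    qed
    show "reach u" if "reach (f u)"
      using that Suc unfolding reach_def by metis
  qed
  have "\<exists>u\<in>U. \<not> reach u"
  proof (rule ccontr)
    assume all: "\<not> ?thesis"
    define d where "d u = (LEAST k. (g ^^ k) u = v)" for u
    have "d (f u) < d u" if u: "u \<in> U" for u
    proof -
      have gu: "u \<noteq> v" "g u = f u" using u v by (auto simp: g_def)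
      have "\<exists>k. (g ^^ k) u = v" using all u unfolding reach_def by blast
      then have du: "(g ^^ d u) u = v" unfolding d_def by (rule LeastI_ex)
      with gu obtain l where l: "d u = Suc l" by (cases "d u") simp_all
      with du gu have "(g ^^ l) (f u) = v" by (simp only: funpow_Suc_right comp_apply)
      then have "d (f u) \<le> l" unfolding d_def by (intro Least_le)
      then show ?thesis using l by simp
    qed
    then show False using r by (auto simp: ranked_def)
  qed
  then obtain u where u: "u \<in> U" "\<not> reach u" by blast
  define x where "x = vec m (\<lambda>j. of_bool (\<not> reach (e j)) :: real)"
  have "x \<noteq> 0\<^sub>v m"
  proof -
    obtain j where "j < m" "e j = u" using u(1) e by (auto simp: bij_betw_def)
    then have "x $ j \<noteq> 0\<^sub>v m $ j" using u by (simp add: x_def)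
    then show ?thesis by metis
  qed
  moreover have "?A *\<^sub>v x = 0\<^sub>v m"
  proof (rule eq_vecI)
    fix i assume "i < dim_vec (0\<^sub>v m :: real vec)"
    then have i: "i < m" by simp
    then have ei: "e i \<in> U" using e by (auto simp: bij_betw_def)
    have "(\<Sum>j<m. of_bool (f (e i) = e j) * x $ j) = of_bool (\<not> reach (f (e i)))"
    proof (cases "f (e i) = v")
      case True
      then have "f (e i) \<noteq> e j" if "j < m" for j using that e v by (auto simp: bij_betw_def)
      moreover have "reach v" unfolding reach_def by (rule exI[of _ 0]) simp
      ultimately show ?thesis using True by simp
    next
      case False
      then obtain k where k: "k < m" "f (e i) = e k" using f ei e by (auto simp: bij_betw_def)
      then have "f (e i) = e j \<longleftrightarrow> j = k" if "j < m" for j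
        using that e by (auto simp: bij_betw_def inj_on_def)
      then have "(\<Sum>j<m. of_bool (f (e i) = e j) * x $ j) = (\<Sum>j<m. if j = k then x $ j else 0)"
        by (intro sum.cong) auto
      then show ?thesis using k by (simp add: x_def)
    qed
    moreover have "(\<Sum>j<m. of_bool (i = j) * x $ j) = of_bool (\<not> reach (e i))"
    proof -
      have "(\<Sum>j<m. of_bool (i = j) * x $ j) = (\<Sum>j<m. if j = i then x $ j else 0)"
        by (intro sum.cong) auto
      then show ?thesis using i by (simp add: x_def)
    qed
    moreover have "(?A *\<^sub>v x) $ i
        = (\<Sum>j<m. of_bool (i = j) * x $ j) - (\<Sum>j<m. of_bool (f (e i) = e j) * x $ j)"
      using i by (simp add: scalar_prod_def x_def atLeast0LessThan left_diff_distrib sum_subtractf)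
    ultimately show "(?A *\<^sub>v x) $ i = 0\<^sub>v m $ i" using i reach_g[OF ei] by simp
  qed simp
  moreover have "x \<in> carrier_vec m" by (simp add: x_def)
  ultimately show ?thesis using det_0_iff_vec_prod_zero[OF mat_carrier] by blast
qed

text \<open>
  The Laplacian without the row and the column of \<open>v\<close>, the remaining vertices being listed by \<open>e\<close>.
  The edges at \<open>v\<close> carry weight \<open>t\<close>, all others weight 1.
\<close>

definition grounded_laplacian :: "'a graph \<Rightarrow> 'a \<Rightarrow> real \<Rightarrow> nat \<Rightarrow> (nat \<Rightarrow> 'a) \<Rightarrow> real mat" where
  "grounded_laplacian G v t m e = mat m m (\<lambda>(i, j).
     \<Sum>y\<in>neighbours G (e i). (if y = v then t else 1) * (of_bool (i = j) - of_bool (y = e j)))"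

text \<open>
  Each row of the grounded Laplacian is a weighted sum over the neighbours \<open>y\<close> of the rows
  \<open>e_i - e_y\<close>. Multilinearity turns the determinant into a sum over all maps that choose a
  neighbour for each vertex, and a map contributes 1 or 0 according to whether it is ranked. The
  degree of \<open>v\<close> is the number of vertices with parent \<open>v\<close>, hence the power of \<open>t\<close>.
\<close>

theorem matrix_tree:
  assumes G: "simple_graph G" and v: "v \<in> verts G" and e: "bij_betw e {..<m} (verts G - {v})"
  shows "(\<Sum>T\<in>spanning_trees G. t ^ Defs.degree T v) = det (grounded_laplacian G v t m e)"
proof -
  let ?U = "verts G - {v}"
  let ?N = "neighbours G"
  let ?w = "\<lambda>y. if y = v then t else 1"
  let ?B = "\<lambda>y i j. of_bool (i = j) - of_bool (y = e j) :: real"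
  define e' where "e' = inv_into {..<m} e"
  have e': "e' (e i) = i" if "i < m" for i using e that by (simp add: e'_def bij_betw_def)
  have finU: "finite ?U" using G by (simp add: simple_graph_def)
  have Nsub: "?N u \<subseteq> verts G" for u using edge_verts(2)[OF G] by (auto simp: neighbours_def)
  have finN: "finite (?N u)" for u
    using Nsub[of u] G by (auto simp: simple_graph_def intro: finite_subset)
  have finP: "finite (PiE ?U ?N)" by (rule finite_PiE[OF finU finN])
  have reindex: "(\<Prod>i = 0..<m. h i (e i)) = (\<Prod>u\<in>?U. h (e' u) u)" for h :: "nat \<Rightarrow> 'a \<Rightarrow> real"
    unfolding prod.reindex_bij_betw[OF e, symmetric] by (simp add: e' atLeast0LessThan)
  have expand: "(\<Prod>i = 0..<m. \<Sum>y\<in>?N (e i). ?w y * ?B y i (p i))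
      = (\<Sum>f\<in>PiE ?U ?N. \<Prod>u\<in>?U. ?w (f u) * ?B (f u) (e' u) (p (e' u)))" for p
    unfolding reindex[of "\<lambda>i u. \<Sum>y\<in>?N u. ?w y * ?B y i (p i)"]
    by (rule prod_sum_PiE[OF finU finN])
  have "det (grounded_laplacian G v t m e)
      = (\<Sum>p | p permutes {0..<m}. signof p * (\<Prod>i = 0..<m. \<Sum>y\<in>?N (e i). ?w y * ?B y i (p i)))"
    unfolding grounded_laplacian_def det_def'[OF mat_carrier]
    by (intro sum.cong arg_cong2[of _ _ _ _ "(*)"] prod.cong refl) (auto simp: permutes_in_image)
  also have "\<dots> = (\<Sum>p | p permutes {0..<m}. signof p *
      (\<Sum>f\<in>PiE ?U ?N. \<Prod>u\<in>?U. ?w (f u) * ?B (f u) (e' u) (p (e' u))))"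
    by (simp only: expand)
  also have "\<dots> = (\<Sum>f\<in>PiE ?U ?N. \<Sum>p | p permutes {0..<m}. signof p *
      (\<Prod>u\<in>?U. ?w (f u) * ?B (f u) (e' u) (p (e' u))))"
    unfolding sum_distrib_left by (rule sum.swap)
  also have "\<dots> = (\<Sum>f\<in>PiE ?U ?N. (\<Prod>u\<in>?U. ?w (f u)) *
      det (mat m m (\<lambda>(i, j). of_bool (i = j) - of_bool (f (e i) = e j))))"
  proof (rule sum.cong[OF refl])
    fix f
    have "det (mat m m (\<lambda>(i, j). of_bool (i = j) - of_bool (f (e i) = e j)))
        = (\<Sum>p | p permutes {0..<m}. signof p * (\<Prod>i = 0..<m. ?B (f (e i)) i (p i)))"
      unfolding det_def'[OF mat_carrier]
      by (intro sum.cong arg_cong2[of _ _ _ _ "(*)"] prod.cong refl) (auto simp: permutes_in_image)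
    also have "\<dots> = (\<Sum>p | p permutes {0..<m}. signof p * (\<Prod>u\<in>?U. ?B (f u) (e' u) (p (e' u))))"
      by (simp only: reindex[of "\<lambda>i u. ?B (f u) i (q i)" for q])
    finally show "(\<Sum>p | p permutes {0..<m}. signof p *
          (\<Prod>u\<in>?U. ?w (f u) * ?B (f u) (e' u) (p (e' u))))
        = (\<Prod>u\<in>?U. ?w (f u)) * det (mat m m (\<lambda>(i, j). of_bool (i = j) - of_bool (f (e i) = e j)))"
      by (simp add: prod.distrib sum_distrib_left mult.left_commute)
  qed
  also have "\<dots> = (\<Sum>f\<in>PiE ?U ?N. if ranked ?U f then t ^ card {u \<in> ?U. f u = v} else 0)"
  proof (rule sum.cong[OF refl])
    fix f assume f: "f \<in> PiE ?U ?N"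
    have "det (mat m m (\<lambda>(i, j). of_bool (i = j) - of_bool (f (e i) = e j) :: real))
        = of_bool (ranked ?U f)"
    proof (cases "ranked ?U f")
      case True
      then obtain d :: "'a \<Rightarrow> nat" where d: "\<And>u. u \<in> ?U \<Longrightarrow> d (f u) < d u"
        unfolding ranked_def by blast
      have "d (e j) < d (e i)" if "i < m" "f (e i) = e j" for i j
        using d[OF bij_betwE[OF e, rule_format, of i]] that by simp
      then show ?thesis
        using det_ranked[where d = "\<lambda>i. d (e i)" and F = "\<lambda>i j. f (e i) = e j" and m = m] True by simp
    next
      case False
      have "f u \<in> insert v ?U" if "u \<in> ?U" for u using PiE_mem[OF f that] Nsub[of u] by auto
      then have "f \<in> ?U \<rightarrow> insert v ?U" by (rule Pi_I)
      from det_unranked[OF e _ this False] False show ?thesis by simp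
    qed
    moreover have "(\<Prod>u\<in>?U. ?w (f u)) = t ^ card {u \<in> ?U. f u = v}"
    proof -
      have "?U \<inter> {u. f u = v} = {u \<in> ?U. f u = v}" by blast
      then show ?thesis unfolding prod.If_cases[OF finU] by simp
    qed
    ultimately show "(\<Prod>u\<in>?U. ?w (f u)) *
          det (mat m m (\<lambda>(i, j). of_bool (i = j) - of_bool (f (e i) = e j)))
        = (if ranked ?U f then t ^ card {u \<in> ?U. f u = v} else 0)" by simp
  qed
  also have "\<dots> = (\<Sum>f\<in>parent_maps G v. t ^ card {u \<in> ?U. f u = v})"
    unfolding parent_maps_def by (rule sum.inter_filter[OF finP, symmetric])
  also have "\<dots> = (\<Sum>f\<in>parent_maps G v. t ^ Defs.degree (parent_graph (verts G) v f) v)"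
    by (simp only: degree_parent_graph)
  also have "\<dots> = (\<Sum>T\<in>spanning_trees G. t ^ Defs.degree T v)"
    by (rule sum.reindex_bij_betw[OF bij_betw_parent_graph[OF G v]])
  finally show ?thesis ..
qed

section \<open>Powers of cycles\<close>

text \<open>
  The vertex of the \<open>n\<close>-cycle reached from \<open>v\<close> by \<open>d\<close> signed steps.
\<close>

definition shift :: "nat \<Rightarrow> nat \<Rightarrow> int \<Rightarrow> nat" where
  "shift n v d = nat ((int v + d) mod int n)"

lemma int_shift: "n > 0 \<Longrightarrow> int (shift n v d) = (int v + d) mod int n"
  by (simp add: shift_def)

lemma shift_less: "n > 0 \<Longrightarrow> shift n v d < n"
  by (simp add: shift_def nat_less_iff)

lemma shift_0: "v < n \<Longrightarrow> shift n v 0 = v"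
  by (simp add: shift_def)

lemma shift_shift: "n > 0 \<Longrightarrow> shift n (shift n v d) e = shift n v (d + e)"
  by (simp add: shift_def mod_add_left_eq add.assoc)

lemma shift_eq_iff: 
  assumes "n > 0" shows "shift n v d = shift n v e \<longleftrightarrow> int n dvd d - e"
proof -
  have "shift n v d = shift n v e \<longleftrightarrow> (int v + d) mod int n = (int v + e) mod int n"
    using int_shift[OF assms] by (metis of_nat_eq_iff)
  also have "\<dots> \<longleftrightarrow> int n dvd (int v + d) - (int v + e)" by (rule mod_eq_dvd_iff)
  finally show ?thesis by simp
qed

text \<open>
  Offsets of absolute value below \<open>n\<close> that are congruent to 0 vanish; all injectivity statements about
  \<open>shift\<close> reduce to this.
\<close>

lemma small_multiple: "int n dvd d \<Longrightarrow> \<bar>d\<bar> < int n \<Longrightarrow> d = 0"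
  by (metis abs_of_nat dvd_imp_le_int not_less)

lemma cycle_edge_iff:
  assumes "n > 0"
  shows "{x, y} \<in> edges (cycle_graph n) \<longleftrightarrow>
    x < n \<and> (y = shift n x 1 \<or> y = shift n x (- 1))"
proof -
  have s: "(i + 1) mod n = shift n i 1" for i by (simp add: shift_def nat_mod_distrib nat_add_distrib)
  have mem: "{x, y} \<in> {{i, h i} |i. i < n} \<longleftrightarrow> x < n \<and> y = h x \<or> y < n \<and> x = h y"
    for h :: "nat \<Rightarrow> nat" unfolding mem_Collect_eq doubleton_eq_iff by blast
  have inv: "x = shift n y 1 \<and> y < n \<longleftrightarrow> y = shift n x (- 1) \<and> x < n" for x y
    using assms by (auto simp: shift_shift shift_less shift_0)
  have "{x, y} \<in> edges (cycle_graph n) \<longleftrightarrow> x < n \<and> y = shift n x 1 \<or> y < n \<and> x = shift n y 1"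
    unfolding cycle_graph_def graph.simps s by (rule mem)
  then show ?thesis using inv[of x y] by blast
qed

lemma cycle_walk_shift:
  assumes n: "n > 0" and p: "walk (cycle_graph n) p"
  shows "\<exists>d. \<bar>d\<bar> \<le> int (length p - 1) \<and> last p = shift n (hd p) d"
  using p
proof (induction p)
  case (Cons x p)
  show ?case
  proof (cases p)
    case Nil
    then show ?thesis using Cons.prems
      by (intro exI[of _ 0]) (simp add: walk_def shift_0 cycle_graph_def)
  next
    case (Cons y ys)
    then have "{x, y} \<in> edges (cycle_graph n)" and p: "walk (cycle_graph n) p"
      using Cons.prems by (auto simp: walk_def)
    then obtain s :: int where s: "\<bar>s\<bar> = 1" "y = shift n x s"
      unfolding cycle_edge_iff[OF n] using that[of 1] that[of "- 1"] by auto
    obtain d where d: "\<bar>d\<bar> \<le> int (length p - 1)" "last p = shift n (hd p) d"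
      using Cons.IH[OF p] by blast
    have "last (x # p) = shift n x (s + d)" using d(2) s(2) Cons n by (simp add: shift_shift)
    moreover have "\<bar>s + d\<bar> \<le> int (length (x # p) - 1)"
      using s(1) d(1) Cons by simp
    ultimately show ?thesis by (intro exI[of _ "s + d"]) simp
  qed
qed (simp add: walk_def)

lemma shift_cycle_walk:
  assumes u: "u < n"
  shows "\<exists>p. walk (cycle_graph n) p \<and> hd p = u \<and> last p = shift n u d \<and> length p = Suc (nat \<bar>d\<bar>)"
proof -
  have n: "n > 0" using u by simp
  have "\<exists>p. walk (cycle_graph n) p \<and> hd p = u \<and> last p = shift n u (s * int m) \<and> length p = Suc m"
    if s: "s = 1 \<or> s = - 1" for s :: int and m
  proof (induction m)
    case 0
    then show ?case using u by (intro exI[of _ "[u]"]) (simp add: walk_def shift_0 cycle_graph_def)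
  next
    case (Suc m)
    then obtain p where p: "walk (cycle_graph n) p" "hd p = u" "last p = shift n u (s * int m)"
      "length p = Suc m" by blast
    let ?y = "shift n u (s * int (Suc m))"
    have y: "?y = shift n (last p) s" unfolding p(3) shift_shift[OF n] by (simp add: algebra_simps)
    have "{last p, ?y} \<in> edges (cycle_graph n)"
      unfolding cycle_edge_iff[OF n] y p(3) using s shift_less[OF n] by auto
    then have "walk (cycle_graph n) (p @ [?y])"
      using p(1) shift_less[OF n] by (simp add: walk_def successively_append_iff cycle_graph_def)
    moreover have "hd (p @ [?y]) = u" using p(1,2) by (simp add: walk_def)
    ultimately show ?case using p(4) by (intro exI[of _ "p @ [?y]"]) simp
  qed
  from this[of 1 "nat \<bar>d\<bar>"] this[of "- 1" "nat \<bar>d\<bar>"] show ?thesis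
    by (cases "d \<ge> 0") simp_all
qed

lemma graph_dist_le_iff:
  "graph_dist G u v \<le> enat k \<longleftrightarrow> (\<exists>p. walk G p \<and> hd p = u \<and> last p = v \<and> length p - 1 \<le> k)"
proof -
  have "graph_dist G u v \<le> enat k \<longleftrightarrow> graph_dist G u v < enat (Suc k)"
    by (cases "graph_dist G u v") auto
  then show ?thesis by (auto simp: graph_dist_def INF_less_iff less_Suc_eq_le)
qed

lemma neighbours_cycle_power:
  assumes k: "k < n" and u: "u < n"
  shows "neighbours (graph_power (cycle_graph n) k) u = shift n u ` ({- int k..int k} - {0})"
proof -
  let ?C = "cycle_graph n"
  have n: "n > 0" using u by simp
  have dist: "graph_dist ?C x y \<le> enat l \<longleftrightarrow> (\<exists>d. \<bar>d\<bar> \<le> int l \<and> y = shift n x d)"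
    if "x < n" for x y l
  proof
    assume "graph_dist ?C x y \<le> enat l"
    then obtain p where p: "walk ?C p" "hd p = x" "last p = y" "length p - 1 \<le> l"
      unfolding graph_dist_le_iff by blast
    obtain d where "\<bar>d\<bar> \<le> int (length p - 1)" "y = shift n x d"
      using cycle_walk_shift[OF n p(1)] p by auto
    then show "\<exists>d. \<bar>d\<bar> \<le> int l \<and> y = shift n x d" using p(4) by (intro exI[of _ d]) auto
  next
    assume "\<exists>d. \<bar>d\<bar> \<le> int l \<and> y = shift n x d"
    then obtain d where d: "\<bar>d\<bar> \<le> int l" "y = shift n x d" by blast
    from shift_cycle_walk[OF \<open>x < n\<close>, of d] obtain p
      where "walk ?C p" "hd p = x" "last p = y" "length p = Suc (nat \<bar>d\<bar>)"
      unfolding d(2) by blast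
    then show "graph_dist ?C x y \<le> enat l"
      unfolding graph_dist_le_iff using d(1) by (intro exI[of _ p]) auto
  qed
  have pos: "1 \<le> graph_dist ?C x y \<longleftrightarrow> x \<noteq> y" if "x < n" for x y
  proof -
    have "1 \<le> graph_dist ?C x y \<longleftrightarrow> \<not> graph_dist ?C x y \<le> enat 0"
      by (cases "graph_dist ?C x y") (auto simp: one_enat_def)
    also have "\<dots> \<longleftrightarrow> y \<noteq> shift n x 0" using dist[OF that, of y 0] by auto
    finally show ?thesis using shift_0[OF that] by auto
  qed
  have edge: "x < n \<and> y < n \<and> 1 \<le> graph_dist ?C x y \<and> graph_dist ?C x y \<le> enat k \<longleftrightarrow>
      x < n \<and> (\<exists>d\<in>{- int k..int k} - {0}. y = shift n x d)" (is "?L x y \<longleftrightarrow> ?R x y") for x y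
  proof (cases "x < n")
    case True
    have ne: "shift n x d \<noteq> x" if d: "d \<in> {- int k..int k} - {0}" for d
    proof
      assume "shift n x d = x"
      then have "int n dvd d" using shift_eq_iff[OF n, of x d 0] shift_0[OF True] by simp
      moreover have "\<bar>d\<bar> < int n" using d k by auto
      ultimately show False using small_multiple[of n d] d by simp
    qed
    have "?L x y" if "?R x y"
    proof -
      from that obtain d where d: "d \<in> {- int k..int k} - {0}" "y = shift n x d" by blast
      then have "\<bar>d\<bar> \<le> int k" by auto
      then have "\<exists>d. \<bar>d\<bar> \<le> int k \<and> y = shift n x d" using d(2) by blast
      moreover have "x \<noteq> y" "y < n" using ne[OF d(1)] d(2) shift_less[OF n] by simp_all
      ultimately show ?thesis unfolding dist[OF True] pos[OF True] using True by blast
    qed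
    moreover have "?R x y" if "?L x y"
    proof -
      from that obtain d where d: "\<bar>d\<bar> \<le> int k" "y = shift n x d" "x \<noteq> y"
        unfolding dist[OF True] pos[OF True] by blast
      then have "d \<noteq> 0" using shift_0[OF True] by auto
      then have "d \<in> {- int k..int k} - {0}" using d(1) by auto
      then show ?thesis using d(2) True by blast
    qed
    ultimately show ?thesis by blast
  qed simp
  have "?R y x \<Longrightarrow> ?R x y" for x y
  proof -
    assume "?R y x"
    then obtain d where d: "d \<in> {- int k..int k} - {0}" "x = shift n y d" "y < n" by blast
    then have "y = shift n x (- d)" unfolding d(2) shift_shift[OF n] by (simp add: shift_0)
    moreover have "x < n" using d shift_less[OF n] by simp
    ultimately show "?R x y" using d(1) by (intro conjI bexI[of _ "- d"]) auto
  qed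
  then have sym: "?R y x \<longleftrightarrow> ?R x y" for x y by blast
  have V: "v \<in> verts ?C \<longleftrightarrow> v < n" for v by (simp add: cycle_graph_def)
  have mem: "{x, y} \<in> {{u, v} |u v. P u v} \<longleftrightarrow> P x y \<or> P y x" for P :: "nat \<Rightarrow> nat \<Rightarrow> bool" and x y
    unfolding mem_Collect_eq doubleton_eq_iff by blast
  have "{u, y} \<in> edges (graph_power ?C k) \<longleftrightarrow> ?L u y \<or> ?L y u" for y
    unfolding graph_power_def graph.simps V by (rule mem)
  then have "{u, y} \<in> edges (graph_power ?C k) \<longleftrightarrow> ?R u y" for y
    by (simp only: edge sym[of u y] disj_absorb)
  then show ?thesis unfolding neighbours_def using u by blast
qed

section \<open>Leaves and the Green function\<close>

text \<open>
  A matrix that commutes with the exchange of the two halves splits over the symmetric and the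
  antisymmetric vectors.
\<close>

lemma det_four_block_swap:
  fixes P :: "'a :: idom mat"
  assumes P: "P \<in> carrier_mat n n" and Q: "Q \<in> carrier_mat n n"
  shows "det (four_block_mat P Q Q P) = det (P + Q) * det (P - Q)"
proof -
  let ?O = "0\<^sub>m n n :: 'a mat" and ?I = "1\<^sub>m n :: 'a mat"
  let ?A = "four_block_mat P Q Q P"
  let ?L = "four_block_mat ?I ?O (- ?I) ?I" and ?R = "four_block_mat ?I ?O ?I ?I"
  note c = P Q
  have A: "?A \<in> carrier_mat (n + n) (n + n)" using c by simp
  have LR: "?L \<in> carrier_mat (n + n) (n + n)" "?R \<in> carrier_mat (n + n) (n + n)" by simp_all
  have "?A * ?R = four_block_mat (P + Q) Q (P + Q) P"
    by (subst mult_four_block_mat[of P n n Q n Q n P ?I n ?O n ?I ?I])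
       (use c in \<open>simp_all add: comm_add_mat[of Q n n P]\<close>)
  moreover have "?L * four_block_mat (P + Q) Q (P + Q) P
      = four_block_mat (P + Q) Q (- (P + Q) + (P + Q)) (- Q + P)"
    by (subst mult_four_block_mat[of ?I n n ?O n "- ?I" n ?I "P + Q" n Q n "P + Q" P])
       (use c in simp_all)
  moreover have "- (P + Q) + (P + Q) = ?O" "- Q + P = P - Q"
    using c by (auto intro!: eq_matI)
  ultimately have "?L * (?A * ?R) = four_block_mat (P + Q) Q ?O (P - Q)" by (simp only:)
  then have "det ?L * (det ?A * det ?R) = det (P + Q) * det (P - Q)"
    using det_mult[OF LR(1) mult_carrier_mat[OF A LR(2)]] det_mult[OF A LR(2)]
      det_four_block_mat_lower_left_zero[of "P + Q" n Q n ?O "P - Q"]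
      minus_carrier_mat[OF Q, of P] c by simp
  moreover have "det ?L = 1" "det ?R = 1"
    using det_four_block_mat_upper_right_zero[of ?I n ?O n "- ?I" ?I]
      det_four_block_mat_upper_right_zero[of ?I n ?O n ?I ?I] by simp_all
  ultimately show ?thesis by simp
qed

text \<open>
  Dividing the generating polynomial of \<open>d\<close> on \<open>S\<close> by \<open>t\<close> and letting \<open>t\<close> tend to 0 leaves the number of
  elements with \<open>d = 1\<close>; divisibility by \<open>t\<close> itself excludes \<open>d = 0\<close>.
\<close>

lemma card_eq_1_limit:
  fixes d :: "'b \<Rightarrow> nat"
  assumes fin: "finite S"
    and eq: "\<And>t :: real. (\<Sum>T\<in>S. t ^ d T) = t * h t" and h: "(h \<longlongrightarrow> L) (at 0)"
  shows "real (card {T \<in> S. d T = 1}) = L"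
proof -
  let ?f = "\<lambda>t. \<Sum>T\<in>S. t ^ (d T - 1) :: real"
  have pos: "d T > 0" if "T \<in> S" for T
  proof -
    have "(\<Sum>T\<in>S. (0 :: real) ^ d T) = 0" using eq[of 0] by simp
    then have "(0 :: real) ^ d T = 0"
      using sum_nonneg_eq_0_iff[OF fin, of "\<lambda>T. (0 :: real) ^ d T"] that by simp
    then show ?thesis by (cases "d T") auto
  qed
  have "?f t = h t" if "t \<noteq> 0" for t
  proof -
    have "t * t ^ (d T - 1) = t ^ d T" if "T \<in> S" for T
      using pos[OF that] by (cases "d T") auto
    then have "t * ?f t = (\<Sum>T\<in>S. t ^ d T)" unfolding sum_distrib_left by (rule sum.cong[OF refl])
    then show ?thesis using eq[of t] that by simp
  qed
  then have "eventually (\<lambda>t. ?f t = h t) (at 0)" by (auto simp: eventually_at_filter)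
  then have "(?f \<longlongrightarrow> L) (at 0)" using h by (simp add: tendsto_cong)
  moreover have "(?f \<longlongrightarrow> ?f 0) (at 0)" by (intro tendsto_intros)
  ultimately have "?f 0 = L" using LIM_unique by blast
  moreover have "(0 :: real) ^ (d T - 1) = (if d T = 1 then 1 else 0)" if "T \<in> S" for T
    using pos[OF that] by (cases "d T") (auto simp: power_0_left)
  then have "?f 0 = (\<Sum>T\<in>S. if d T = 1 then 1 else 0)" by (rule sum.cong[OF refl])
  ultimately show ?thesis using sum.inter_filter[OF fin, of "\<lambda>_. 1 :: real" "\<lambda>T. d T = 1"] by simp
qed

text \<open>
  The expansion of a \<open>4 \<times> 4\<close> determinant along its first two rows: products of complementary
  \<open>2 \<times> 2\<close> minors. It turns the limits and the exact evaluation below into ring computations.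
\<close>

definition det4 :: "(nat \<Rightarrow> nat \<Rightarrow> 'a :: comm_ring_1) \<Rightarrow> 'a" where
  "det4 A =
     (A 0 0 * A 1 1 - A 0 1 * A 1 0) * (A 2 2 * A 3 3 - A 2 3 * A 3 2)
   - (A 0 0 * A 1 2 - A 0 2 * A 1 0) * (A 2 1 * A 3 3 - A 2 3 * A 3 1)
   + (A 0 0 * A 1 3 - A 0 3 * A 1 0) * (A 2 1 * A 3 2 - A 2 2 * A 3 1)
   + (A 0 1 * A 1 2 - A 0 2 * A 1 1) * (A 2 0 * A 3 3 - A 2 3 * A 3 0)
   - (A 0 1 * A 1 3 - A 0 3 * A 1 1) * (A 2 0 * A 3 2 - A 2 2 * A 3 0)
   + (A 0 2 * A 1 3 - A 0 3 * A 1 2) * (A 2 0 * A 3 1 - A 2 1 * A 3 0)"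

lemma det_mat_Suc:
  "det (mat (Suc m) (Suc m) f)
    = (\<Sum>j<Suc m. f (0, j) * ((- 1) ^ j * det (mat m m (\<lambda>(i, k). f (Suc i, if k < j then k else Suc k)))))"
proof -
  have "mat_delete (mat (Suc m) (Suc m) f) 0 j
      = mat m m (\<lambda>(i, k). f (Suc i, if k < j then k else Suc k))" for j
    by (rule eq_matI) (auto simp: mat_delete_def)
  then show ?thesis
    by (subst laplace_expansion_row[OF mat_carrier, of 0]) (auto simp: cofactor_def)
qed

lemma det_mat_4: "det (mat 4 4 (\<lambda>(i, j). A i j)) = det4 A"
proof -
  have 4: "4 = Suc (Suc (Suc (Suc 0)))" by simp
  have num: "1 = Suc 0" "2 = Suc (Suc 0)" "3 = Suc (Suc (Suc 0))" by simp_all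
  show ?thesis unfolding 4 det4_def num
    by (simp add: det_mat_Suc algebra_simps)
qed

lemma det4_row_sum:
  assumes "\<And>i. i < 4 \<Longrightarrow> A i 0 + A i 1 + A i 2 + A i 3 = t"
  shows "det4 A = t * det4 (\<lambda>i j. if j = 0 then 1 else A i j)"
proof -
  have "A i 0 = t - A i 1 - A i 2 - A i 3" if "i < 4" for i
    using assms[OF that] by (simp add: algebra_simps)
  then have eqs: "A 0 0 = t - A 0 1 - A 0 2 - A 0 3" "A 1 0 = t - A 1 1 - A 1 2 - A 1 3"
    "A 2 0 = t - A 2 1 - A 2 2 - A 2 3" "A 3 0 = t - A 3 1 - A 3 2 - A 3 3" by simp_all
  show ?thesis unfolding det4_def eqs by (simp add: algebra_simps)
qed

lemma tendsto_det4:
  fixes f :: "'b \<Rightarrow> nat \<Rightarrow> nat \<Rightarrow> real"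
  assumes "\<And>i j. i < 4 \<Longrightarrow> j < 4 \<Longrightarrow> ((\<lambda>x. f x i j) \<longlongrightarrow> A i j) F"
  shows "((\<lambda>x. det4 (f x)) \<longlongrightarrow> det4 A) F"
  unfolding det4_def by (intro tendsto_intros assms) simp_all

text \<open>
  An enumeration of the vertices other than the root, as signed distances from it: first the
  neighbours \<open>1, 2, 3, 4\<close>, then their mirror images \<open>-1, -2, -3, -4\<close>, then the rest. With this order
  the matrix below is block triangular with an \<open>8 \<times> 8\<close> block symmetric under reflection.
\<close>

definition offset :: "nat \<Rightarrow> int" where
  "offset i = (if i < 4 then int i + 1 else if i < 8 then 3 - int i else int i - 3)"

lemma bij_betw_offset:
  assumes "n \<ge> 9"
  shows "bij_betw offset {..<n - 1} ({- 4..int n - 5} - {0})"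
proof (rule bij_betw_imageI)
  show "inj_on offset {..<n - 1}" by (auto simp: inj_on_def offset_def split: if_splits)
  show "offset ` {..<n - 1} = {- 4..int n - 5} - {0}"
  proof (intro equalityI subsetI)
    fix d assume d: "d \<in> {- 4..int n - 5} - {0}"
    consider "1 \<le> d" "d \<le> 4" | "d < 0" | "d \<ge> 5" using d by force
    then show "d \<in> offset ` {..<n - 1}"
    proof cases
      case 1
      then show ?thesis using assms by (intro image_eqI[of _ _ "nat (d - 1)"]) (auto simp: offset_def)
    next
      case 2
      then show ?thesis using assms d by (intro image_eqI[of _ _ "nat (3 - d)"]) (auto simp: offset_def)
    next
      case 3
      then show ?thesis using assms d by (intro image_eqI[of _ _ "nat (d + 3)"]) (auto simp: offset_def)
    qed
  qed (use assms in \<open>auto simp: offset_def\<close>)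
qed

lemma bij_betw_shift_offset:
  assumes n: "n \<ge> 9" and v: "v < n"
  shows "bij_betw (\<lambda>i. shift n v (offset i)) {..<n - 1} ({..<n} - {v})"
proof -
  let ?D = "{- 4..int n - 5} - {0}"
  have n0: "n > 0" using n by simp
  have inj: "inj_on (shift n v) (insert 0 ?D)"
  proof (rule inj_onI)
    fix d e assume de: "d \<in> insert 0 ?D" "e \<in> insert 0 ?D" and "shift n v d = shift n v e"
    then have "int n dvd d - e" using shift_eq_iff[OF n0] by simp
    moreover have "\<bar>d - e\<bar> < int n" using de n by auto
    ultimately show "d = e" using small_multiple[of n "d - e"] by simp
  qed
  have "shift n v ` insert 0 ?D \<subseteq> {..<n}" using shift_less[OF n0] by auto
  moreover have "card (shift n v ` insert 0 ?D) = n"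
  proof -
    have "insert 0 ?D = {- 4..int n - 5}" using n by auto
    then show ?thesis using card_image[OF inj] by simp
  qed
  ultimately have "shift n v ` insert 0 ?D = {..<n}" by (intro card_subset_eq) auto
  moreover have "v \<notin> shift n v ` ?D"
    using inj shift_0[OF v] by (auto simp: inj_on_def)
  ultimately have "shift n v ` ?D = {..<n} - {v}"
    using shift_0[OF v] by (metis Diff_insert_absorb image_insert)
  then have "bij_betw (shift n v) ?D ({..<n} - {v})"
    using inj by (auto simp: bij_betw_def intro: inj_on_subset)
  from bij_betw_trans[OF bij_betw_offset[OF n] this] show ?thesis by (simp add: comp_def)
qed

abbreviation steps :: "int set" where "steps \<equiv> {- 4..4} - {0}"

text \<open>
  The function \<open>a\<close> is the potential kernel of the Laplacian of the fourth power of the \<open>n\<close>-cycle: its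
  Laplacian is a unit sink at 0, compensated by a uniform source.
\<close>

locale cycle_green =
  fixes n :: nat and a :: "int \<Rightarrow> real"
  assumes n: "n \<ge> 9"
    and periodic: "\<And>k l. int n dvd k - l \<Longrightarrow> a k = a l"
    and even: "\<And>k. a (- k) = a k"
    and zero: "a 0 = 0"
    and laplace: "\<And>k. 8 * a k - (\<Sum>d\<in>steps. a (k + d)) = 1 / real n - of_bool (int n dvd k)"
begin

text \<open>
  The Green function of the Laplacian grounded at 0. As a function of \<open>k\<close> it is, up to a constant, a
  difference of two kernels; their uniform sources cancel and leave opposite unit charges at \<open>l\<close> and at
  the ground.
\<close>

definition green :: "int \<Rightarrow> int \<Rightarrow> real" where
  "green k l = a k + a l - a (k - l)"

abbreviation G :: "nat graph" where "G \<equiv> graph_power (cycle_graph n) 4"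

lemma n_pos: "n > 0" using n by simp

lemma verts_G: "verts G = {..<n}" by (simp add: graph_power_def cycle_graph_def)

lemma simple_G: "simple_graph G"
  by (rule simple_graph_graph_power) (simp add: cycle_graph_def)

lemma sum_neighbours:
  assumes "v < n"
  shows "(\<Sum>y\<in>neighbours G (shift n v k). F y) = (\<Sum>d\<in>steps. F (shift n v (k + d)))"
proof -
  have "inj_on (shift n (shift n v k)) steps"
  proof (rule inj_onI)
    fix d e assume de: "d \<in> steps" "e \<in> steps" "shift n (shift n v k) d = shift n (shift n v k) e"
    then have "int n dvd d - e" using shift_eq_iff[OF n_pos] by simp
    moreover have "\<bar>d - e\<bar> < int n" using de n by auto
    ultimately show "d = e" using small_multiple[of n "d - e"] by simp
  qed
  moreover have "neighbours G (shift n v k) = shift n (shift n v k) ` steps"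
    using neighbours_cycle_power[of 4 n "shift n v k"] n shift_less[OF n_pos] by simp
  ultimately show ?thesis by (simp only: sum.reindex o_def shift_shift[OF n_pos])
qed

definition vertex :: "nat \<Rightarrow> nat \<Rightarrow> nat" where "vertex v i = shift n v (offset i)"

lemma bij_vertex: "v < n \<Longrightarrow> bij_betw (vertex v) {..<n - 1} ({..<n} - {v})"
  unfolding vertex_def by (rule bij_betw_shift_offset[OF n])

lemma vertex_inject: "v < n \<Longrightarrow> i < n - 1 \<Longrightarrow> j < n - 1 \<Longrightarrow> vertex v i = vertex v j \<longleftrightarrow> i = j"
  using bij_vertex[of v] by (auto simp: bij_betw_def inj_on_def)

lemma vertex_not_root: "v < n \<Longrightarrow> i < n - 1 \<Longrightarrow> vertex v i \<noteq> v"
  using bij_betwE[OF bij_vertex[of v]] by auto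

lemma laplacian_entry:
  assumes "v < n" "i < n - 1" "j < n - 1"
  shows "grounded_laplacian G v t (n - 1) (vertex v) $$ (i, j)
    = (\<Sum>d\<in>steps. (if shift n v (offset i + d) = v then t else 1)
        * (of_bool (i = j) - of_bool (shift n v (offset i + d) = vertex v j)))"
  using assms by (simp add: grounded_laplacian_def vertex_def sum_neighbours)

lemma shift_root_iff: "v < n \<Longrightarrow> shift n v k = v \<longleftrightarrow> int n dvd k"
  using shift_eq_iff[OF n_pos, of v k 0] shift_0[of v n] by simp

text \<open>
  Only the diagonal entries of the eight neighbours of the root depend on \<open>t\<close>.
\<close>

lemma laplacian_entry_root_weight:
  assumes v: "v < n" and i: "i < n - 1" and j: "j < n - 1"
  shows "grounded_laplacian G v t (n - 1) (vertex v) $$ (i, j)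
    = grounded_laplacian G v 1 (n - 1) (vertex v) $$ (i, j) - (1 - t) * of_bool (i = j \<and> i < 8)"
proof -
  let ?c = "\<lambda>d. of_bool (shift n v (offset i + d) = v) :: real"
  have "(\<Sum>d\<in>steps. ?c d) = of_bool (i < 8)"
  proof -
    have "?c d = (if d = - offset i then 1 else 0)" if "d \<in> steps" for d
    proof -
      have "offset i + d = 0" if "int n dvd offset i + d"
      proof -
        have "- int n < offset i + d" "offset i + d < int n"
          using i n \<open>d \<in> steps\<close> by (auto simp: offset_def)
        then show ?thesis using small_multiple[OF that] by simp
      qed
      then show ?thesis unfolding shift_root_iff[OF v] by auto
    qed
    then have "(\<Sum>d\<in>steps. ?c d) = (\<Sum>d\<in>steps. if d = - offset i then 1 else 0)"
      by (rule sum.cong[OF refl])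
    also have "\<dots> = of_bool (- offset i \<in> steps)" by simp
    also have "- offset i \<in> steps \<longleftrightarrow> i < 8" by (auto simp: offset_def)
    finally show ?thesis .
  qed
  moreover have "grounded_laplacian G v t (n - 1) (vertex v) $$ (i, j)
      - grounded_laplacian G v 1 (n - 1) (vertex v) $$ (i, j)
      = - (1 - t) * of_bool (i = j) * (\<Sum>d\<in>steps. ?c d)"
    unfolding laplacian_entry[OF v i j] sum_subtractf[symmetric] sum_distrib_left
    by (intro sum.cong refl) (use vertex_not_root[OF v j] in auto)
  ultimately have "grounded_laplacian G v t (n - 1) (vertex v) $$ (i, j)
      - grounded_laplacian G v 1 (n - 1) (vertex v) $$ (i, j)
      = - (1 - t) * of_bool (i = j) * of_bool (i < 8)" by (simp only:)
  then show ?thesis unfolding of_bool_conj by (simp add: algebra_simps)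
qed

lemma laplacian_apply:
  assumes v: "v < n" and i: "i < n - 1"
    and h: "\<And>k l. int n dvd k - l \<Longrightarrow> h k = h l" "h 0 = 0"
  shows "(\<Sum>l<n - 1. grounded_laplacian G v 1 (n - 1) (vertex v) $$ (i, l) * h (offset l))
    = 8 * h (offset i) - (\<Sum>d\<in>steps. h (offset i + d))"
proof -
  let ?w = "\<lambda>d. shift n v (offset i + d)"
  have step: "(\<Sum>l<n - 1. (of_bool (i = l) - of_bool (?w d = vertex v l)) * h (offset l))
      = h (offset i) - h (offset i + d)" for d
  proof -
    have "(\<Sum>l<n - 1. of_bool (?w d = vertex v l) * h (offset l)) = h (offset i + d)"
    proof (cases "?w d = v")
      case True
      then have "?w d \<noteq> vertex v l" if "l < n - 1" for l using vertex_not_root[OF v that] by simp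
      moreover have "h (offset i + d) = 0"
        using True h(1)[of "offset i + d" 0] h(2) shift_root_iff[OF v] by simp
      ultimately show ?thesis by simp
    next
      case False
      then have "?w d \<in> vertex v ` {..<n - 1}"
        using bij_vertex[OF v] shift_less[OF n_pos] by (simp add: bij_betw_def)
      then obtain k where k: "k < n - 1" "?w d = vertex v k" by auto
      have "(\<Sum>l<n - 1. of_bool (?w d = vertex v l) * h (offset l))
          = (\<Sum>l<n - 1. if l = k then h (offset l) else 0)"
        unfolding k(2) using vertex_inject[OF v k(1)] by (intro sum.cong) auto
      also have "\<dots> = h (offset k)" using k(1) by simp
      also have "\<dots> = h (offset i + d)"
        using k(2) h(1)[of "offset k" "offset i + d"] shift_eq_iff[OF n_pos]
        unfolding vertex_def by metis
      finally show ?thesis .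
    qed
    moreover have "(\<Sum>l<n - 1. of_bool (i = l) * h (offset l)) = h (offset i)"
      using i by (simp add: of_bool_def if_distrib[of "\<lambda>x. x * _"] cong: if_cong)
    ultimately show ?thesis by (simp add: left_diff_distrib sum_subtractf)
  qed
  have "(\<Sum>l<n - 1. grounded_laplacian G v 1 (n - 1) (vertex v) $$ (i, l) * h (offset l))
      = (\<Sum>l<n - 1. \<Sum>d\<in>steps. (of_bool (i = l) - of_bool (?w d = vertex v l)) * h (offset l))"
  proof (rule sum.cong[OF refl])
    fix l assume "l \<in> {..<n - 1}"
    then have l: "l < n - 1" by simp
    have "(if ?w d = v then 1 else 1) * x = x" for d and x :: real by simp
    then show "grounded_laplacian G v 1 (n - 1) (vertex v) $$ (i, l) * h (offset l)
        = (\<Sum>d\<in>steps. (of_bool (i = l) - of_bool (?w d = vertex v l)) * h (offset l))"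
      unfolding laplacian_entry[OF v i l] sum_distrib_right by (simp only:)
  qed
  also have "\<dots> = (\<Sum>d\<in>steps. h (offset i) - h (offset i + d))"
    unfolding sum.swap[of _ steps] step ..
  finally show ?thesis by (simp add: sum_subtractf)
qed

lemma green_periodic: "int n dvd k - k' \<Longrightarrow> green k l = green k' l"
  unfolding green_def using periodic[of k k'] periodic[of "k - l" "k' - l"] by simp

lemma green_0: "green 0 l = 0" using zero even[of l] by (simp add: green_def)

lemma green_minus: "green (- k) (- l) = green k l"
  using even[of "k - l"] even[of k] even[of l] by (simp add: green_def)

lemma laplace_green:
  "8 * green k l - (\<Sum>d\<in>steps. green (k + d) l) = of_bool (int n dvd k - l) - of_bool (int n dvd k)"
proof -
  have "(\<Sum>d\<in>steps. green (k + d) l)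
      = (\<Sum>d\<in>steps. a (k + d)) + 8 * a l - (\<Sum>d\<in>steps. a ((k - l) + d))"
    by (simp add: green_def sum.distrib sum_subtractf algebra_simps)
  then show ?thesis using laplace[of k] laplace[of "k - l"] by (simp add: green_def)
qed

text \<open>
  For \<open>s = 1\<close> and \<open>s = -1\<close> these are the blocks, acting on symmetric and antisymmetric vectors, of
  \<open>I - (1 - t) g\<close> restricted to the eight neighbours of the root.
\<close>

definition green_block :: "real \<Rightarrow> real \<Rightarrow> real mat" where
  "green_block t s = mat 4 4 (\<lambda>(i, j). of_bool (i = j)
     - (1 - t) * (green (int i + 1) (int j + 1) + s * green (int i + 1) (- (int j + 1))))"

text \<open>
  With \<open>X\<close> the columns of the Green function at the eight neighbours and zero columns elsewhere,
  \<open>L_1 X\<close> is the diagonal indicator matrix of the neighbours. Hence \<open>L_t = L_1 (I - (1 - t) X)\<close>,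
  where the second factor is block triangular and the determinant of \<open>L_1\<close> counts spanning trees.
\<close>

lemma det_laplacian:
  notes One_nat_def [simp del]
  assumes v: "v < n"
  shows "det (grounded_laplacian G v t (n - 1) (vertex v))
    = real (\<tau> G) * det (green_block t 1) * det (green_block t (- 1))"
proof -
  let ?m = "n - 1"
  let ?L = "\<lambda>t. grounded_laplacian G v t ?m (vertex v)"
  let ?X = "\<lambda>i j. if j < 8 then green (offset i) (offset j) else 0"
  let ?K = "mat ?m ?m (\<lambda>(i, j). of_bool (i = j) - (1 - t) * ?X i j)"
  have L: "?L t \<in> carrier_mat ?m ?m" for t by (simp add: grounded_laplacian_def)
  have "?L t = ?L 1 * ?K"
  proof (rule eq_matI)
    fix i j assume "i < dim_row (?L 1 * ?K)" "j < dim_col (?L 1 * ?K)"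
    then have i: "i < ?m" and j: "j < ?m" using carrier_matD[OF L[of 1]] by simp_all
    have "(\<Sum>l<?m. ?L 1 $$ (i, l) * ?X l j) = of_bool (i = j \<and> i < 8)"
    proof (cases "j < 8")
      case True
      have "int n dvd offset i - offset j \<longleftrightarrow> i = j"
        using vertex_inject[OF v i j] shift_eq_iff[OF n_pos] by (simp add: vertex_def)
      moreover have "\<not> int n dvd offset i"
        using vertex_not_root[OF v i] shift_root_iff[OF v] by (simp add: vertex_def)
      ultimately show ?thesis
        using True laplacian_apply[OF v i, of "\<lambda>k. green k (offset j)"] green_periodic green_0
          laplace_green[of "offset i" "offset j"] by auto
    qed auto
    moreover have "(\<Sum>l<?m. ?L 1 $$ (i, l) * of_bool (l = j)) = ?L 1 $$ (i, j)"
      using j by (simp add: of_bool_def if_distrib[of "\<lambda>x. _ * x"] cong: if_cong)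
    moreover have "(?L 1 * ?K) $$ (i, j) = (\<Sum>l<?m. ?L 1 $$ (i, l) * ?K $$ (l, j))"
      using i j L[of 1] by (simp add: scalar_prod_def atLeast0LessThan)
    moreover have "\<dots> = (\<Sum>l<?m. ?L 1 $$ (i, l) * of_bool (l = j))
        - (1 - t) * (\<Sum>l<?m. ?L 1 $$ (i, l) * ?X l j)"
      unfolding sum_distrib_left sum_subtractf[symmetric]
      using j by (intro sum.cong refl) (simp add: algebra_simps)
    ultimately show "?L t $$ (i, j) = (?L 1 * ?K) $$ (i, j)"
      using laplacian_entry_root_weight[OF v i j, of t] by simp
  qed (use carrier_matD[OF L] in simp_all)
  then have "det (?L t) = det (?L 1) * det ?K"
    using det_mult[OF L[of 1], of ?K] by simp
  moreover have "det (?L 1) = real (\<tau> G)"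
    using matrix_tree[OF simple_G, of v "vertex v" ?m 1] bij_vertex[OF v] v
    by (simp add: verts_G \<tau>_def)
  moreover have "det ?K = det (green_block t 1) * det (green_block t (- 1))"
  proof -
    let ?P = "mat 4 4 (\<lambda>(i, j). of_bool (i = j) - (1 - t) * green (int i + 1) (int j + 1))"
    let ?Q = "mat 4 4 (\<lambda>(i, j). - ((1 - t) * green (int i + 1) (- (int j + 1))))"
    let ?C = "mat (?m - 8) 8 (\<lambda>(i, j). - ((1 - t) * green (offset (i + 8)) (offset j)))"
    let ?A = "four_block_mat ?P ?Q ?Q ?P"
    have K: "?K = four_block_mat ?A (0\<^sub>m 8 (?m - 8)) ?C (1\<^sub>m (?m - 8))"
    proof (rule eq_matI)
      let ?B = "four_block_mat ?A (0\<^sub>m 8 (?m - 8)) ?C (1\<^sub>m (?m - 8))"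
      fix i j assume "i < dim_row ?B" "j < dim_col ?B"
      then have i: "i < ?m" and j: "j < ?m" using n by auto
      \<comment> \<open>In the rows of the mirror images, the invariance of the Green function under reflection identifies the blocks.\<close>
      consider "i < 4" | "4 \<le> i" "i < 8" | "i \<ge> 8" by linarith
      then show "?K $$ (i, j) = ?B $$ (i, j)"
      proof cases
        case 1
        then show ?thesis using i j n by (auto simp: offset_def of_nat_diff)
      next
        case 2
        have "green (3 - int i) l = green (int (i - 4) + 1) (- l)" for l
          using green_minus[of "3 - int i" l] 2 by (simp add: of_nat_diff algebra_simps)
        then show ?thesis using 2 i j n by (auto simp: offset_def of_nat_diff)
      next
        case 3
        then show ?thesis using i j n by (auto simp: offset_def of_nat_diff)
      qed
    qed (use n in auto)
    have "?A \<in> carrier_mat 8 8"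
      using four_block_carrier_mat[of ?P 4 4 ?P 4 4 ?Q ?Q] by simp
    from det_four_block_mat_upper_right_zero[OF this refl, of ?C "?m - 8" "1\<^sub>m (?m - 8)"]
    have "det ?K = det ?A" unfolding K by simp
    also have "\<dots> = det (?P + ?Q) * det (?P - ?Q)"
      by (rule det_four_block_swap[of _ 4]) simp_all
    also have "?P + ?Q = green_block t 1"
      by (rule eq_matI) (auto simp: green_block_def algebra_simps)
    also have "?P - ?Q = green_block t (- 1)"
      by (rule eq_matI) (auto simp: green_block_def algebra_simps)
    finally show ?thesis .
  qed
  ultimately show ?thesis by simp
qed

text \<open>
  The function that is 1 off the root and 0 at the root has Laplacian 1 at the neighbours of the root,
  so summing the Green function over these neighbours gives 1.
\<close>

lemma row_sum_one:
  assumes "i < 4"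
  shows "(\<Sum>j<4. green (int i + 1) (int j + 1) + green (int i + 1) (- (int j + 1))) = 1"
proof -
  let ?k = "int i + 1"
  have "steps = {- 4, - 3, - 2, - 1, 1, 2, 3, 4}" by force
  moreover have "{..<4 :: nat} = {0, 1, 2, 3}" by auto
  ultimately have sum_steps: "(\<Sum>d\<in>steps. h d) = (\<Sum>j<4. h (int j + 1) + h (- (int j + 1)))"
    for h :: "int \<Rightarrow> real" by simp
  have "\<not> int n dvd ?k" using small_multiple[of n ?k] assms n by auto
  then have *: "8 * a ?k - (\<Sum>d\<in>steps. a (?k + d)) = 1 / real n"
    using laplace[of ?k] by simp
  have "(\<Sum>d\<in>steps. green ?k d) = 8 * a ?k + (\<Sum>d\<in>steps. a d) - (\<Sum>d\<in>steps. a (?k - d))"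
    by (simp add: green_def sum.distrib sum_subtractf)
  also have "(\<Sum>d\<in>steps. a (?k - d)) = (\<Sum>d\<in>steps. a (?k + d))"
    unfolding sum_steps by (simp add: add.commute)
  also have "(\<Sum>d\<in>steps. a d) = 1 - 1 / real n" using laplace[of 0] zero by simp
  finally show ?thesis using * unfolding sum_steps by simp
qed

text \<open>
  Factoring \<open>t\<close> out of the symmetric block leaves a column of ones; this is the remaining factor at
  \<open>t = 0\<close>.
\<close>

definition symmetric_det :: real where
  "symmetric_det = det4 (\<lambda>i j. if j = 0 then 1 else
     of_bool (i = j) - (green (int i + 1) (int j + 1) + green (int i + 1) (- (int j + 1))))"

definition antisymmetric_det :: real where
  "antisymmetric_det = det4 (\<lambda>i j.
     of_bool (i = j) - (green (int i + 1) (int j + 1) - green (int i + 1) (- (int j + 1))))"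

text \<open>
  The root is a leaf of exactly the trees counted by the coefficient of \<open>t\<close> in the degree generating
  polynomial, which is the determinant of the grounded Laplacian.
\<close>

lemma card_leaf_trees:
  assumes v: "v < n"
  shows "real (card {T \<in> spanning_trees G. Defs.degree T v = 1})
    = real (\<tau> G) * symmetric_det * antisymmetric_det"
proof (rule card_eq_1_limit)
  let ?B = "\<lambda>t s i j. of_bool (i = j)
     - (1 - t) * (green (int i + 1) (int j + 1) + s * green (int i + 1) (- (int j + 1)))"
  let ?S = "\<lambda>t i j. if j = 0 then 1 else ?B t 1 i j"
  show "finite (spanning_trees G)" by (rule finite_spanning_trees[OF simple_G])
  fix t
  have "(\<Sum>T\<in>spanning_trees G. t ^ Defs.degree T v) = det (grounded_laplacian G v t (n - 1) (vertex v))"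
    using matrix_tree[OF simple_G] bij_vertex[OF v] v by (simp add: verts_G)
  also have "\<dots> = real (\<tau> G) * det4 (?B t 1) * det4 (?B t (- 1))"
    unfolding det_laplacian[OF v] green_block_def det_mat_4 ..
  also have "det4 (?B t 1) = t * det4 (?S t)"
  proof (rule det4_row_sum)
    fix i :: nat assume i: "i < 4"
    have "(\<Sum>j<4. ?B t 1 i j) = (\<Sum>j<4. of_bool (i = j))
        - (1 - t) * (\<Sum>j<4. green (int i + 1) (int j + 1) + green (int i + 1) (- (int j + 1)))"
      by (simp add: sum_subtractf sum_distrib_left)
    also have "\<dots> = t" unfolding row_sum_one[OF i] using i by simp
    finally show "?B t 1 i 0 + ?B t 1 i 1 + ?B t 1 i 2 + ?B t 1 i 3 = t"
      by (simp add: numeral_eq_Suc add.assoc)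
  qed
  finally show "(\<Sum>T\<in>spanning_trees G. t ^ Defs.degree T v)
      = t * (real (\<tau> G) * det4 (?S t) * det4 (?B t (- 1)))" by simp
next
  let ?B = "\<lambda>t s i j. of_bool (i = j)
     - (1 - t) * (green (int i + 1) (int j + 1) + s * green (int i + 1) (- (int j + 1)))"
  let ?S = "\<lambda>t i j. if j = 0 then 1 else ?B t 1 i j"
  have B: "((\<lambda>t. ?B t s i j) \<longlongrightarrow> ?B 0 s i j) (at 0)" for s i j
    by (intro tendsto_intros)
  have "((\<lambda>t. det4 (?S t)) \<longlongrightarrow> det4 (?S 0)) (at 0)"
  proof (rule tendsto_det4)
    show "((\<lambda>t. ?S t i j) \<longlongrightarrow> ?S 0 i j) (at 0)" for i j
      by (cases "j = 0") (simp_all only: B tendsto_const simp_thms if_True if_False)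
  qed
  moreover have "((\<lambda>t. det4 (?B t (- 1))) \<longlongrightarrow> det4 (?B 0 (- 1))) (at 0)"
    by (rule tendsto_det4[OF B])
  moreover have "det4 (?S 0) = symmetric_det" "det4 (?B 0 (- 1)) = antisymmetric_det"
    by (simp_all add: symmetric_det_def antisymmetric_det_def cong: if_cong)
  ultimately show "((\<lambda>t. real (\<tau> G) * det4 (?S t) * det4 (?B t (- 1)))
      \<longlongrightarrow> real (\<tau> G) * symmetric_det * antisymmetric_det) (at 0)"
    by (intro tendsto_mult tendsto_const) simp_all
qed

lemma \<tau>_pos: "\<tau> G > 0"
proof -
  let ?f = "restrict (\<lambda>u. u - 1) ({..<n} - {0})"
  have "u - 1 \<in> neighbours G u" if "u \<in> {..<n} - {0}" for u
  proof -
    have "u - 1 = shift n u (- 1)" using that by (auto simp: shift_def)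
    then show ?thesis using neighbours_cycle_power[of 4 n u] n that by auto
  qed
  moreover have "ranked ({..<n} - {0}) ?f"
    unfolding ranked_def by (rule exI[of _ "\<lambda>u. u"]) auto
  ultimately have "?f \<in> parent_maps G 0" by (auto simp: parent_maps_def verts_G)
  then have "spanning_trees G \<noteq> {}"
    using bij_betw_parent_graph[OF simple_G, of 0] n_pos by (auto simp: verts_G bij_betw_def)
  then show ?thesis
    using finite_spanning_trees[OF simple_G] by (simp add: \<tau>_def card_gt_0_iff)
qed

text \<open>
  The number of trees in which \<open>v\<close> is a leaf does not depend on \<open>v\<close>, so exchanging the sums over trees
  and vertices cancels the factor \<open>n\<close>.
\<close>

theorem BZ_ratio_eq: "BZ_ratio (\<lambda>n. graph_power (cycle_graph n) 4) n = symmetric_det * antisymmetric_det"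
proof -
  let ?S = "spanning_trees G"
  have leaves: "card (leaves T) = (\<Sum>v<n. of_bool (Defs.degree T v = 1))" if "T \<in> ?S" for T
  proof -
    have "leaves T = {v \<in> {..<n}. Defs.degree T v = 1}"
      using that verts_G by (auto simp: leaves_def spanning_trees_def)
    then show ?thesis by (simp add: Int_def)
  qed
  have "real (\<Sum>T\<in>?S. card (leaves T)) = (\<Sum>T\<in>?S. \<Sum>v<n. of_bool (Defs.degree T v = 1))"
    using leaves by simp
  also have "\<dots> = (\<Sum>v<n. \<Sum>T\<in>?S. of_bool (Defs.degree T v = 1))" by (rule sum.swap)
  also have "\<dots> = (\<Sum>v<n. real (\<tau> G) * symmetric_det * antisymmetric_det)"
  proof (rule sum.cong[OF refl])
    fix v assume "v \<in> {..<n}"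
    then show "(\<Sum>T\<in>?S. of_bool (Defs.degree T v = 1)) = real (\<tau> G) * symmetric_det * antisymmetric_det"
      using card_leaf_trees[of v] finite_spanning_trees[OF simple_G] by (simp add: Int_def)
  qed
  also have "\<dots> = real n * real (\<tau> G) * (symmetric_det * antisymmetric_det)" by simp
  finally show ?thesis using n_pos \<tau>_pos by (simp add: BZ_ratio_def)
qed

end

section \<open>The potential kernel in Fourier form\<close>

definition freq :: "nat \<Rightarrow> nat \<Rightarrow> real" where
  "freq n j = 2 * pi * real j / real n"

lemma freq_0: "freq n 0 = 0" by (simp add: freq_def)

text \<open>
  The symbol of the Laplacian of the fourth power of a cycle, divided by \<open>2 - 2 cos x\<close>. Unlike the
  former it has no zero, since it is \<open>(2 cos x + 1)^3 + 3\<close>.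
\<close>

definition symbol :: "real \<Rightarrow> real" where
  "symbol x = 2 * cos (3 * x) + 6 * cos (2 * x) + 12 * cos x + 10"

lemma cos_3_4:
  "cos (3 * x) = 4 * cos x ^ 3 - 3 * cos x" "cos (4 * x) = 8 * cos x ^ 4 - 8 * cos x ^ 2 + (1 :: real)"
proof -
  show "cos (3 * x) = 4 * cos x ^ 3 - 3 * cos x" by (rule cos_treble_cos)
  have "cos (4 * x) = 2 * cos (2 * x) ^ 2 - 1" using cos_double_cos[of "2 * x"] by simp
  then show "cos (4 * x) = 8 * cos x ^ 4 - 8 * cos x ^ 2 + 1"
    unfolding cos_double_cos[of x] by (simp add: power2_eq_square power4_eq_xxxx algebra_simps)
qed

lemma symbol_cube: "symbol x = (2 * cos x + 1) ^ 3 + 3"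
  unfolding symbol_def cos_3_4 cos_double_cos[of x]
  by (simp add: power2_eq_square power3_eq_cube algebra_simps)

lemma symbol_ge: "symbol x \<ge> 2"
proof -
  have "(- 1) ^ 3 \<le> (2 * cos x + 1) ^ 3"
    by (rule power_mono_odd) (use cos_ge_minus_one[of x] in \<open>simp_all, linarith\<close>)
  then show ?thesis by (simp add: symbol_cube)
qed

lemma laplacian_symbol:
  "8 - 2 * (cos x + cos (2 * x) + cos (3 * x) + cos (4 * x)) = (2 - 2 * cos x) * symbol x"
  unfolding symbol_def cos_3_4 cos_double_cos[of x]
  by (simp add: power2_eq_square power3_eq_cube power4_eq_xxxx algebra_simps)

lemma cos_freq_eq_1_iff:
  assumes "n > 0"
  shows "cos (of_int k * freq n 1) = 1 \<longleftrightarrow> int n dvd k"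
proof
  assume "cos (of_int k * freq n 1) = 1"
  then obtain m :: int where "of_int k * freq n 1 = of_int m * 2 * pi" using cos_one_2pi_int by blast
  then have "real_of_int k = real_of_int (m * int n)" using assms by (simp add: freq_def field_simps)
  then have "k = m * int n" by (simp only: of_int_eq_iff)
  then show "int n dvd k" by simp
next
  assume "int n dvd k"
  then obtain m where "k = int n * m" by (auto elim: dvdE)
  then have "of_int k * freq n 1 = 2 * pi * of_int m" using assms by (simp add: freq_def)
  then show "cos (of_int k * freq n 1) = 1" by (simp only: cos_int_2pin)
qed

lemma sum_cos_freq:
  assumes "n > 0"
  shows "(\<Sum>j<n. cos (of_int k * freq n j)) = real n * of_bool (int n dvd k)"
proof -
  define z where "z = cis (of_int k * freq n 1)"
  have power: "z ^ j = cis (of_int k * freq n j)" for j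
    by (simp add: z_def DeMoivre freq_def mult.commute mult.left_commute)
  then have Re: "(\<Sum>j<n. cos (of_int k * freq n j)) = Re (\<Sum>j<n. z ^ j)"
    by (simp only: Re_sum cis.sel)
  have "of_int k * freq n n = 2 * pi * of_int k" using assms by (simp add: freq_def)
  then have zn: "z ^ n = 1"
    by (simp only: power complex_eq_iff cis.sel cos_int_2pin sin_int_2pin one_complex.sel)
  show ?thesis
  proof (cases "int n dvd k")
    case True
    then have "cos (of_int k * freq n 1) = 1" using cos_freq_eq_1_iff[OF assms] by simp
    then have "z = 1" unfolding z_def using sin_cos_squared_add[of "of_int k * freq n 1"]
      by (simp add: complex_eq_iff)
    then show ?thesis using Re True by simp
  next
    case False
    then have "z \<noteq> 1" using cos_freq_eq_1_iff[OF assms, of k] by (auto simp: z_def complex_eq_iff)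
    then have "(\<Sum>j<n. z ^ j) = 0" using zn by (simp add: geometric_sum)
    then show ?thesis using Re False by simp
  qed
qed

text \<open>
  The potential kernel in Fourier form. The frequency 0, at which the Laplacian vanishes, is left out;
  this produces the uniform source \<open>1/n\<close>.
\<close>

definition potential :: "nat \<Rightarrow> int \<Rightarrow> real" where
  "potential n k = (\<Sum>j\<in>{1..<n}.
     (1 - cos (of_int k * freq n j)) / ((2 - 2 * cos (freq n j)) * symbol (freq n j))) / real n"

text \<open>
  The inverse on the cycle of the difference operator with symbol \<open>symbol\<close>. It is, up to a constant
  that vanishes as \<open>n\<close> grows, the second difference of the potential kernel.
\<close>

definition curvature :: "nat \<Rightarrow> int \<Rightarrow> real" where
  "curvature n k = (\<Sum>j<n. cos (of_int k * freq n j) / symbol (freq n j)) / real n"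

lemma cos_freq_periodic:
  assumes "n > 0" "int n dvd k - l"
  shows "cos (of_int k * freq n j) = cos (of_int l * freq n j)"
proof -
  obtain m where "k - l = int n * m" using assms(2) by (auto elim: dvdE)
  then have "k = l + int n * m" by simp
  then have "of_int k * freq n j = of_int l * freq n j + 2 * pi * of_int (m * int j)"
    using assms(1) by (simp add: freq_def field_simps)
  then show ?thesis by (simp add: cos_add del: of_int_mult)
qed

lemma cos_freq_less_1:
  assumes "j \<in> {1..<n}" shows "cos (freq n j) < 1"
proof -
  have "\<not> int n dvd int j" using assms by (auto dest: zdvd_imp_le)
  moreover have "freq n j = of_int (int j) * freq n 1" by (simp add: freq_def)
  ultimately have "cos (freq n j) \<noteq> 1" using cos_freq_eq_1_iff[of n "int j"] assms by simp
  then show ?thesis by (rule le_neq_trans[OF cos_le_one])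
qed

lemma potential_periodic: "n > 0 \<Longrightarrow> int n dvd k - l \<Longrightarrow> potential n k = potential n l"
  by (simp add: potential_def cos_freq_periodic[of n k l])

lemma potential_even: "potential n (- k) = potential n k"
  by (simp add: potential_def)

lemma potential_0: "potential n 0 = 0"
  by (simp add: potential_def)

lemma curvature_periodic: "n > 0 \<Longrightarrow> int n dvd k - l \<Longrightarrow> curvature n k = curvature n l"
  by (simp add: curvature_def cos_freq_periodic[of n k l])

lemma curvature_even: "curvature n (- k) = curvature n k"
  by (simp add: curvature_def)

lemma sum_nonzero_freq:
  fixes f :: "nat \<Rightarrow> real"
  assumes "n > 0" shows "(\<Sum>j\<in>{1..<n}. f j) = (\<Sum>j<n. f j) - f 0"
proof -
  have "{..<n} = insert 0 {1..<n}" using assms by auto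
  then show ?thesis by simp
qed

lemma cos_add_diff: "cos (x + y) + cos (x - y) = 2 * cos x * cos (y :: real)"
  by (simp add: cos_add cos_diff)

lemma sum_steps: "(\<Sum>d\<in>steps. h d) = h (- 4) + h (- 3) + h (- 2) + h (- 1) + h 1 + h 2 + h 3 + h 4"
  for h :: "int \<Rightarrow> real"
proof -
  have "steps = {- 4, - 3, - 2, - 1, 1, 2, 3, 4}" by force
  then show ?thesis by simp
qed

lemma potential_laplace:
  assumes n: "n > 0"
  shows "8 * potential n k - (\<Sum>d\<in>steps. potential n (k + d)) = 1 / real n - of_bool (int n dvd k)"
proof -
  let ?c = "\<lambda>k j. cos (of_int k * freq n j)"
  let ?l = "\<lambda>j. (2 - 2 * cos (freq n j)) * symbol (freq n j)"
  have num: "8 * (1 - ?c k j) - (\<Sum>d\<in>steps. 1 - ?c (k + d) j) = - ?c k j * ?l j" for j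
  proof -
    have "?c (k + d) j + ?c (k - d) j = 2 * ?c k j * cos (of_int d * freq n j)" for d
      using cos_add_diff[of "of_int k * freq n j" "of_int d * freq n j"] by (simp add: algebra_simps)
    from this[of 1] this[of 2] this[of 3] this[of 4]
    have "(\<Sum>d\<in>steps. ?c (k + d) j) = 2 * ?c k j * (cos (freq n j) + cos (2 * freq n j)
        + cos (3 * freq n j) + cos (4 * freq n j))"
      by (simp add: sum_steps algebra_simps)
    moreover have "(\<Sum>d\<in>steps. 1 - ?c (k + d) j) = 8 - (\<Sum>d\<in>steps. ?c (k + d) j)"
      by (simp add: sum_steps)
    ultimately show ?thesis unfolding laplacian_symbol[symmetric] by (simp add: algebra_simps)
  qed
  have each: "8 * ((1 - ?c k j) / ?l j) - (\<Sum>d\<in>steps. (1 - ?c (k + d) j) / ?l j) = - ?c k j"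
    if "j \<in> {1..<n}" for j
  proof -
    have "?l j \<noteq> 0" using cos_freq_less_1[OF that] symbol_ge[of "freq n j"] by simp
    then have "(8 * (1 - ?c k j) - (\<Sum>d\<in>steps. 1 - ?c (k + d) j)) / ?l j = - ?c k j"
      unfolding num by (rule nonzero_mult_div_cancel_right)
    moreover have "8 * (u / l) - (\<Sum>d\<in>D. w d / l) = (8 * u - (\<Sum>d\<in>D. w d)) / l"
      for u l :: real and w and D :: "int set" by (simp add: diff_divide_distrib sum_divide_distrib)
    ultimately show ?thesis by (simp only:)
  qed
  have "8 * potential n k - (\<Sum>d\<in>steps. potential n (k + d))
      = (\<Sum>j\<in>{1..<n}. 8 * ((1 - ?c k j) / ?l j) - (\<Sum>d\<in>steps. (1 - ?c (k + d) j) / ?l j)) / real n"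
    unfolding potential_def sum_subtractf sum_divide_distrib[symmetric] sum_distrib_left[symmetric]
      sum.swap[of _ "{1..<n}"] by (simp add: diff_divide_distrib)
  also have "(\<Sum>j\<in>{1..<n}. 8 * ((1 - ?c k j) / ?l j) - (\<Sum>d\<in>steps. (1 - ?c (k + d) j) / ?l j))
      = - (\<Sum>j\<in>{1..<n}. ?c k j)"
    unfolding sum_negf[symmetric] by (rule sum.cong[OF refl each])
  also have "(\<Sum>j\<in>{1..<n}. ?c k j) = real n * of_bool (int n dvd k) - 1"
    using sum_nonzero_freq[OF n, of "?c k"] sum_cos_freq[OF n, of k] by (simp only: freq_0) simp
  finally show ?thesis using n by (simp add: field_simps)
qed

lemma cycle_green_potential: "n \<ge> 9 \<Longrightarrow> cycle_green n (potential n)"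
  by unfold_locales
    (auto simp: potential_even potential_0 potential_laplace intro: potential_periodic)

lemma potential_second_difference:
  assumes n: "n > 0"
  shows "potential n (k + 1) - 2 * potential n k + potential n (k - 1)
    = curvature n k - 1 / (30 * real n)"
proof -
  let ?c = "\<lambda>k j. cos (of_int k * freq n j)"
  let ?l = "\<lambda>j. (2 - 2 * cos (freq n j)) * symbol (freq n j)"
  have each: "(1 - ?c (k + 1) j) / ?l j - 2 * ((1 - ?c k j) / ?l j) + (1 - ?c (k - 1) j) / ?l j
      = ?c k j / symbol (freq n j)" if "j \<in> {1..<n}" for j
  proof -
    have "?c (k + 1) j + ?c (k - 1) j = 2 * ?c k j * cos (freq n j)"
      using cos_add_diff[of "of_int k * freq n j" "freq n j"] by (simp add: algebra_simps)
    then have "(1 - ?c (k + 1) j) - 2 * (1 - ?c k j) + (1 - ?c (k - 1) j)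
        = (2 - 2 * cos (freq n j)) * ?c k j" by (simp add: algebra_simps)
    moreover have "2 - 2 * cos (freq n j) \<noteq> 0" using cos_freq_less_1[OF that] by simp
    moreover have "u / (l * q) - 2 * (v / (l * q)) + w / (l * q) = x / q"
      if "u - 2 * v + w = l * x" "l \<noteq> 0" for u v w x l q :: real
    proof -
      have "u / (l * q) - 2 * (v / (l * q)) + w / (l * q) = (u - 2 * v + w) / (l * q)"
        by (simp add: diff_divide_distrib add_divide_distrib)
      then show ?thesis using that by simp
    qed
    ultimately show ?thesis by blast
  qed
  have "potential n (k + 1) - 2 * potential n k + potential n (k - 1)
      = (\<Sum>j\<in>{1..<n}. (1 - ?c (k + 1) j) / ?l j - 2 * ((1 - ?c k j) / ?l j)
          + (1 - ?c (k - 1) j) / ?l j) / real n"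
    unfolding potential_def sum_subtractf sum.distrib sum_distrib_left[symmetric]
    by (simp add: diff_divide_distrib add_divide_distrib)
  also have "\<dots> = (\<Sum>j\<in>{1..<n}. ?c k j / symbol (freq n j)) / real n"
    by (intro arg_cong2[of _ _ _ _ "(/)"] sum.cong refl each)
  also have "(\<Sum>j\<in>{1..<n}. ?c k j / symbol (freq n j)) = (\<Sum>j<n. ?c k j / symbol (freq n j)) - 1 / 30"
    unfolding sum_nonzero_freq[OF n] by (simp add: freq_0 symbol_def)
  finally show ?thesis by (simp add: curvature_def diff_divide_distrib)
qed

lemma curvature_recurrence:
  assumes n: "n > 0"
  shows "curvature n (k + 3) + curvature n (k - 3) + 3 * (curvature n (k + 2) + curvature n (k - 2))
    + 6 * (curvature n (k + 1) + curvature n (k - 1)) + 10 * curvature n k = of_bool (int n dvd k)"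
proof -
  let ?c = "\<lambda>k j. cos (of_int k * freq n j)"
  let ?P = "\<lambda>j. symbol (freq n j)"
  have each: "?c (k + 3) j / ?P j + ?c (k - 3) j / ?P j + 3 * (?c (k + 2) j / ?P j + ?c (k - 2) j / ?P j)
      + 6 * (?c (k + 1) j / ?P j + ?c (k - 1) j / ?P j) + 10 * (?c k j / ?P j) = ?c k j" for j
  proof -
    have "?c (k + d) j + ?c (k - d) j = 2 * ?c k j * cos (of_int d * freq n j)" for d
      using cos_add_diff[of "of_int k * freq n j" "of_int d * freq n j"] by (simp add: algebra_simps)
    from this[of 1] this[of 2] this[of 3]
    have "?c (k + 3) j + ?c (k - 3) j + 3 * (?c (k + 2) j + ?c (k - 2) j)
        + 6 * (?c (k + 1) j + ?c (k - 1) j) + 10 * ?c k j = ?c k j * ?P j"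
      unfolding symbol_def by (simp add: algebra_simps)
    moreover have "?P j \<noteq> 0" using symbol_ge[of "freq n j"] by simp
    moreover have "u1 / q + u2 / q + 3 * (u3 / q + u4 / q) + 6 * (u5 / q + u6 / q) + 10 * (u7 / q) = x"
      if "u1 + u2 + 3 * (u3 + u4) + 6 * (u5 + u6) + 10 * u7 = x * q" "q \<noteq> 0"
      for u1 u2 u3 u4 u5 u6 u7 x q :: real
    proof -
      have "u1 / q + u2 / q + 3 * (u3 / q + u4 / q) + 6 * (u5 / q + u6 / q) + 10 * (u7 / q)
          = (u1 + u2 + 3 * (u3 + u4) + 6 * (u5 + u6) + 10 * u7) / q"
        by (simp add: add_divide_distrib)
      then show ?thesis using that by simp
    qed
    ultimately show ?thesis by blast
  qed
  have "curvature n (k + 3) + curvature n (k - 3) + 3 * (curvature n (k + 2) + curvature n (k - 2))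
      + 6 * (curvature n (k + 1) + curvature n (k - 1)) + 10 * curvature n k
      = (\<Sum>j<n. ?c (k + 3) j / ?P j + ?c (k - 3) j / ?P j + 3 * (?c (k + 2) j / ?P j + ?c (k - 2) j / ?P j)
      + 6 * (?c (k + 1) j / ?P j + ?c (k - 1) j / ?P j) + 10 * (?c k j / ?P j)) / real n"
    unfolding curvature_def sum.distrib sum_distrib_left[symmetric]
    by (simp add: add_divide_distrib)
  also have "\<dots> = of_bool (int n dvd k)" unfolding each sum_cos_freq[OF n] using n by simp
  finally show ?thesis .
qed

lemma curvature_bound: "\<bar>curvature n k\<bar> \<le> 1 / 2"
proof (cases "n = 0")
  case False
  have "\<bar>cos x / symbol y\<bar> \<le> 1 / 2" for x y
  proof -
    have "\<bar>cos x\<bar> / symbol y \<le> 1 / 2" by (rule frac_le) (use symbol_ge[of y] in simp_all)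
    then show ?thesis using symbol_ge[of y] by (simp add: abs_divide)
  qed
  then have "\<bar>\<Sum>j<n. cos (of_int k * freq n j) / symbol (freq n j)\<bar> \<le> (\<Sum>j<n. 1 / 2)"
    by (intro order_trans[OF sum_abs sum_mono])
  then show ?thesis using False by (simp add: curvature_def field_simps)
qed (simp add: curvature_def)

section \<open>Limits by spectral factorization\<close>

text \<open>
  If the coefficients are small enough for \<open>\<mu> ^ i\<close> to be a supersolution, then any solution decays like
  \<open>\<mu> ^ i\<close>. On the cycle the recurrence is interrupted at the multiples
  of \<open>n\<close>, hence the bound \<open>N\<close>.
\<close>

lemma linear_recurrence_decay:
  fixes x :: "nat \<Rightarrow> real" and \<mu> :: real
  assumes rec: "\<And>i. i < N \<Longrightarrow> x (i + 4) = - (A3 * x (i + 3) + A2 * x (i + 2) + A1 * x (i + 1) + A0 * x i)"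
    and \<mu>: "0 < \<mu>" "\<mu> \<le> 1"
    and contraction: "\<bar>A3\<bar> * \<mu> ^ 3 + \<bar>A2\<bar> * \<mu> ^ 2 + \<bar>A1\<bar> * \<mu> + \<bar>A0\<bar> \<le> \<mu> ^ 4"
    and init: "\<And>i. i < 4 \<Longrightarrow> \<bar>x i\<bar> \<le> B"
  shows "i < N + 4 \<Longrightarrow> \<bar>x i\<bar> \<le> B / \<mu> ^ 3 * \<mu> ^ i"
proof (induction i rule: less_induct)
  case (less i)
  have B: "B \<ge> 0" using init[of 0] by simp
  show ?case
  proof (cases "i < 4")
    case True
    then have "\<mu> ^ 3 \<le> \<mu> ^ i" using \<mu> by (intro power_decreasing) auto
    then have "B * \<mu> ^ 3 \<le> B * \<mu> ^ i" using B by (rule mult_left_mono)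
    moreover have "\<bar>x i\<bar> \<le> B" using init[OF True] .
    ultimately show ?thesis using \<mu>(1) by (simp add: field_simps) (smt (verit) mult_right_mono zero_less_power)
  next
    case False
    then have "i = (i - 4) + 4" by simp
    then obtain k where i: "i = k + 4" by blast
    define C where "C = B / \<mu> ^ 3 * \<mu> ^ k"
    have C: "C \<ge> 0" using B \<mu> by (simp add: C_def)
    have IH: "\<bar>x (k + d)\<bar> \<le> C * \<mu> ^ d" if "d < 4" for d
      using less.IH[of "k + d"] less.prems that by (simp add: i C_def power_add mult.assoc)
    have "\<bar>x i\<bar> \<le> \<bar>A3\<bar> * \<bar>x (k + 3)\<bar> + \<bar>A2\<bar> * \<bar>x (k + 2)\<bar> + \<bar>A1\<bar> * \<bar>x (k + 1)\<bar> + \<bar>A0\<bar> * \<bar>x k\<bar>"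
      using rec[of k] less.prems unfolding i abs_mult[symmetric] by linarith
    also have "\<dots> \<le> \<bar>A3\<bar> * (C * \<mu> ^ 3) + \<bar>A2\<bar> * (C * \<mu> ^ 2) + \<bar>A1\<bar> * (C * \<mu> ^ 1) + \<bar>A0\<bar> * (C * \<mu> ^ 0)"
      using IH[of 0] IH[of 1] IH[of 2] IH[of 3] by (intro add_mono mult_left_mono) simp_all
    also have "\<dots> = C * (\<bar>A3\<bar> * \<mu> ^ 3 + \<bar>A2\<bar> * \<mu> ^ 2 + \<bar>A1\<bar> * \<mu> + \<bar>A0\<bar>)"
      by (simp add: algebra_simps)
    also have "\<dots> \<le> C * \<mu> ^ 4" using contraction C by (rule mult_left_mono)
    finally show ?thesis by (simp add: i C_def power_add)
  qed
qed

text \<open>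
  The first three equations say that \<open>q z = z^3 + p z^2 + r z + s\<close> satisfies
  \<open>q z * q (1/z) = s * (z^3 + 3 z^2 + 6 z + 10 + 6/z + 3/z^2 + 1/z^3)\<close>, whose right-hand side is \<open>s\<close>
  times \<open>symbol\<close> on the unit circle. The bounds single out the factor \<open>q\<close> with all roots inside
  the unit disc.
\<close>

locale spectral_factor =
  fixes p r s :: real
  assumes coeff_2: "r + p * s = 3 * s"
    and coeff_1: "p + p * r + r * s = 6 * s"
    and coeff_0: "1 + p ^ 2 + r ^ 2 + s ^ 2 = 10 * s"
    and p: "63 / 100 \<le> p" "p \<le> 18 / 25" and r: "9 / 25 \<le> r" "r \<le> 41 / 100" and s: "3 / 20 \<le> s" "s \<le> 4 / 25"
begin

text \<open>
  Applying \<open>q (1/S)\<close>, with \<open>S\<close> the shift, to the curvature leaves a solution of the recurrence with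
  characteristic polynomial \<open>q\<close>, except at the multiples of \<open>n\<close>.
\<close>

definition filtered :: "nat \<Rightarrow> int \<Rightarrow> real" where
  "filtered n k = curvature n (k - 3) + p * curvature n (k - 2) + r * curvature n (k - 1)
     + s * curvature n k"

lemma filtered_minus: "filtered n (- k) = curvature n (k + 3) + p * curvature n (k + 2)
    + r * curvature n (k + 1) + s * curvature n k"
  using curvature_even[of n "k + 3"] curvature_even[of n "k + 2"] curvature_even[of n "k + 1"]
    curvature_even[of n k] by (simp add: filtered_def)

lemma filtered_recurrence:
  assumes "n > 0"
  shows "filtered n (k + 3) + p * filtered n (k + 2) + r * filtered n (k + 1) + s * filtered n k
    = s * of_bool (int n dvd k)"
proof -
  let ?c = "curvature n"
  have "filtered n (k + 3) + p * filtered n (k + 2) + r * filtered n (k + 1) + s * filtered n k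
      = s * (?c (k + 3) + ?c (k - 3)) + (r + p * s) * (?c (k + 2) + ?c (k - 2))
        + (p + p * r + r * s) * (?c (k + 1) + ?c (k - 1)) + (1 + p ^ 2 + r ^ 2 + s ^ 2) * ?c k"
    by (simp add: filtered_def algebra_simps power2_eq_square)
  also have "\<dots> = s * (?c (k + 3) + ?c (k - 3) + 3 * (?c (k + 2) + ?c (k - 2))
        + 6 * (?c (k + 1) + ?c (k - 1)) + 10 * ?c k)"
    unfolding coeff_0 coeff_1 coeff_2 by (simp add: algebra_simps)
  finally show ?thesis unfolding curvature_recurrence[OF assms] .
qed

lemma filtered_periodic: "n > 0 \<Longrightarrow> filtered n (k + int n) = filtered n k"
  unfolding filtered_def
  using curvature_periodic[of n "k + int n" k] curvature_periodic[of n "k + int n - 1" "k - 1"]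
    curvature_periodic[of n "k + int n - 2" "k - 2"] curvature_periodic[of n "k + int n - 3" "k - 3"]
  by simp

lemma filtered_bound: "\<bar>filtered n k\<bar> \<le> 2"
proof -
  have "\<bar>q * curvature n l\<bar> \<le> q / 2" if "q \<ge> 0" for q l
    using mult_left_mono[OF curvature_bound[of n l] that] that by (simp add: abs_mult)
  then have "\<bar>p * curvature n (k - 2)\<bar> \<le> p / 2" "\<bar>r * curvature n (k - 1)\<bar> \<le> r / 2"
    "\<bar>s * curvature n k\<bar> \<le> s / 2" using p r s by simp_all
  with curvature_bound[of n "k - 3"]
  have "\<bar>filtered n k\<bar> \<le> 1 / 2 + p / 2 + r / 2 + s / 2"
    unfolding filtered_def abs_le_iff by linarith
  then show ?thesis using p r s by simp
qed

text \<open>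
  The coefficients of \<open>q\<close> itself are not small enough for a contraction, but those of
  \<open>(z - 3/10) * q z\<close> are.
\<close>

lemma filtered_decay:
  assumes n: "n > 0" and i: "i < n + 2"
  shows "\<bar>filtered n (int i + 1)\<bar> \<le> 2 / (9 / 10) ^ 3 * (9 / 10) ^ i"
proof -
  let ?x = "\<lambda>i. filtered n (int i + 1)"
  have rec: "?x (i + 4) = - ((p - 3 / 10) * ?x (i + 3) + (r - 3 / 10 * p) * ?x (i + 2)
      + (s - 3 / 10 * r) * ?x (i + 1) + - (3 / 10 * s) * ?x i)" if "i < n - 2" for i
  proof -
    have "\<not> int n dvd int i + 1" "\<not> int n dvd int i + 2"
      using that by (auto dest: zdvd_imp_le)
    then show ?thesis
      using filtered_recurrence[OF n, of "int i + 1"] filtered_recurrence[OF n, of "int i + 2"]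
      by (simp add: algebra_simps)
  qed
  have "\<bar>p - 3 / 10\<bar> * (9 / 10) ^ 3 + \<bar>r - 3 / 10 * p\<bar> * (9 / 10) ^ 2
      + \<bar>s - 3 / 10 * r\<bar> * (9 / 10) + \<bar>- (3 / 10 * s)\<bar> \<le> (9 / 10) ^ 4"
    using p r s by (simp add: abs_if power_numeral_reduce field_simps)
  from linear_recurrence_decay[OF rec _ _ this, of "n - 2" 2 i]
  show ?thesis using i filtered_bound by auto
qed

text \<open>
  Running once around the cycle, from just after the source at 0 to just before the source at \<open>n\<close>,
  the solution has decayed to nothing.
\<close>

lemma filtered_tendsto_0:
  assumes "k \<le> 2" shows "(\<lambda>n. filtered n k) \<longlonglongrightarrow> 0"
proof -
  define m where "m = nat (2 - k)"
  have k: "k = 2 - int m" using assms by (simp add: m_def)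
  have "(\<lambda>n. (9 / 10 :: real) ^ (n - m)) \<longlonglongrightarrow> 0"
    by (rule LIMSEQ_offset[of _ m]) (simp add: LIMSEQ_power_zero)
  then show ?thesis
  proof (rule tendsto_0_le)
    show "eventually (\<lambda>n. norm (filtered n k) \<le> norm ((9 / 10 :: real) ^ (n - m)) * (9 / 10 * (2 / (9 / 10) ^ 3))) sequentially"
    proof (rule eventually_sequentiallyI)
      fix n assume "m + 1 \<le> n"
      then have nm: "n > 0" "n - m + 1 < n + 2" "k + int n = int (n - m + 1) + 1"
        by (auto simp: k of_nat_diff)
      show "norm (filtered n k) \<le> norm ((9 / 10 :: real) ^ (n - m)) * (9 / 10 * (2 / (9 / 10) ^ 3))"
        using filtered_decay[OF nm(1,2)] filtered_periodic[OF nm(1), of k]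
        unfolding nm(3) by (simp add: power_abs mult.commute)
    qed
  qed
qed

lemma filtered_tendsto_s: "(\<lambda>n. filtered n 3) \<longlonglongrightarrow> s"
proof -
  have "(\<lambda>n. s - p * filtered n 2 - r * filtered n 1 - s * filtered n 0) \<longlonglongrightarrow> s - p * 0 - r * 0 - s * 0"
    by (intro tendsto_intros filtered_tendsto_0) simp_all
  moreover have "eventually (\<lambda>n. s - p * filtered n 2 - r * filtered n 1 - s * filtered n 0 = filtered n 3) sequentially"
    using eventually_gt_at_top[of 0]
  proof eventually_elim
    case (elim n)
    then show ?case using filtered_recurrence[of n 0] by (simp add: algebra_simps)
  qed
  ultimately show ?thesis by (simp add: filterlim_cong[OF refl refl] tendsto_cong)
qed

text \<open>
  Eliminating the unknowns \<open>e 3\<close>, \<open>e 2\<close>, \<open>e 1\<close> in turn from the four equations leaves \<open>z * e 0\<close> with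
  \<open>z \<noteq> 0\<close>, so the system determines its solution continuously.
\<close>

lemma yule_walker_null:
  fixes e :: "nat \<Rightarrow> nat \<Rightarrow> real"
  assumes y0: "(\<lambda>n. e n 3 + p * e n 2 + r * e n 1 + s * e n 0) \<longlonglongrightarrow> 0"
    and y1: "(\<lambda>n. e n 2 + p * e n 1 + r * e n 0 + s * e n 1) \<longlonglongrightarrow> 0"
    and y2: "(\<lambda>n. e n 1 + p * e n 0 + r * e n 1 + s * e n 2) \<longlonglongrightarrow> 0"
    and y3: "(\<lambda>n. e n 0 + p * e n 1 + r * e n 2 + s * e n 3) \<longlonglongrightarrow> 0"
  shows "(\<lambda>n. e n 0) \<longlonglongrightarrow> 0" "(\<lambda>n. e n 1) \<longlonglongrightarrow> 0"
    "(\<lambda>n. e n 2) \<longlonglongrightarrow> 0" "(\<lambda>n. e n 3) \<longlonglongrightarrow> 0"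
proof -
  define d where "d = 1 + r - s * (p + s)"
  define f where "f = p - s * r - (p + s) * (r - s * p)"
  define z where "z = d * (1 - s ^ 2 - r * (r - s * p)) - f * (p - s * r)"
  have null: "(\<lambda>n. x n) \<longlonglongrightarrow> 0" if "(\<lambda>n. c * x n) \<longlonglongrightarrow> 0" "c \<noteq> 0" for c :: real and x
    using tendsto_mult_left[OF that(1), of "1 / c"] that(2) by simp
  have d: "d \<noteq> 0" and z: "z \<noteq> 0"
  proof -
    define u where "u = r - s * p"
    define w where "w = p - s * r"
    have "(3 / 20) * (63 / 100) \<le> s * p" "s * p \<le> (4 / 25) * (18 / 25)" "(3 / 20) * (9 / 25) \<le> s * r" "s * (p + s) \<le> (4 / 25) * (22 / 25)"
      "s ^ 2 \<le> (4 / 25) ^ 2"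
      using p r s by (intro mult_mono power_mono; linarith)+
    then have u: "6 / 25 \<le> u" "u \<le> 8 / 25" and w: "w \<le> 67 / 100" and d1: "6 / 5 \<le> d" and ss: "s ^ 2 \<le> 3 / 100"
      using p r s unfolding u_def w_def d_def by (simp_all add: power2_eq_square)
    have ru': "r * u \<le> (41 / 100) * (8 / 25)" "(78 / 100) * (6 / 25) \<le> (p + s) * u"
      using p r s u by (intro mult_mono; linarith)+
    have ru: "4 / 5 \<le> 1 - s ^ 2 - r * u" using ru'(1) ss by linarith
    have "f = w - (p + s) * u" unfolding f_def u_def w_def ..
    then have f: "f \<le> 1 / 2" using ru'(2) w by linarith
    have w0: "0 \<le> w" using mult_mono[of s "4 / 25" r "41 / 100"] p r s by (simp add: w_def)
    have "f * w \<le> (1 / 2) * (67 / 100)" using f w w0 by (intro mult_mono; linarith)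
    moreover have "(6 / 5) * (4 / 5) \<le> d * (1 - s ^ 2 - r * u)" using d1 ru by (intro mult_mono; linarith)
    moreover have "z = d * (1 - s ^ 2 - r * u) - f * w" unfolding z_def u_def w_def ..
    ultimately have "z > 0" by linarith
    then show "d \<noteq> 0" "z \<noteq> 0" using d1 by simp_all
  qed
  let ?y0 = "\<lambda>n. e n 3 + p * e n 2 + r * e n 1 + s * e n 0"
  let ?y1 = "\<lambda>n. e n 2 + p * e n 1 + r * e n 0 + s * e n 1"
  let ?y2 = "\<lambda>n. e n 1 + p * e n 0 + r * e n 1 + s * e n 2"
  let ?y3 = "\<lambda>n. e n 0 + p * e n 1 + r * e n 2 + s * e n 3"
  have z0: "z * e n 0 = d * (?y3 n - s * ?y0 n - (r - s * p) * ?y1 n) - f * (?y2 n - s * ?y1 n)" for n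
  proof -
    have "?y3 n - s * ?y0 n - (r - s * p) * ?y1 n = (1 - s ^ 2 - r * (r - s * p)) * e n 0 + f * e n 1"
      by (simp add: f_def algebra_simps power2_eq_square)
    moreover have "?y2 n - s * ?y1 n = d * e n 1 + (p - s * r) * e n 0"
      by (simp add: d_def algebra_simps)
    ultimately show ?thesis unfolding z_def by (simp only:) (simp add: algebra_simps)
  qed
  have d1: "d * e n 1 = ?y2 n - s * ?y1 n - (p - s * r) * e n 0" for n
    by (simp add: d_def algebra_simps)
  have "(\<lambda>n. z * e n 0) \<longlonglongrightarrow> d * (0 - s * 0 - (r - s * p) * 0) - f * (0 - s * 0)"
    unfolding z0 by (intro tendsto_diff tendsto_mult tendsto_const y0 y1 y2 y3)
  then have "(\<lambda>n. z * e n 0) \<longlonglongrightarrow> 0" by simp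
  from null[OF this z] show e0: "(\<lambda>n. e n 0) \<longlonglongrightarrow> 0" .
  have "(\<lambda>n. d * e n 1) \<longlonglongrightarrow> 0 - s * 0 - (p - s * r) * 0"
    unfolding d1 by (intro tendsto_diff tendsto_mult tendsto_const y1 y2 e0)
  then have "(\<lambda>n. d * e n 1) \<longlonglongrightarrow> 0" by simp
  from null[OF this d] show e1: "(\<lambda>n. e n 1) \<longlonglongrightarrow> 0" .
  have "(\<lambda>n. ?y1 n - (p + s) * e n 1 - r * e n 0) \<longlonglongrightarrow> 0 - (p + s) * 0 - r * 0"
    by (intro tendsto_diff tendsto_mult tendsto_const y1 e0 e1)
  then show e2: "(\<lambda>n. e n 2) \<longlonglongrightarrow> 0" by (simp add: algebra_simps)
  have "(\<lambda>n. ?y0 n - p * e n 2 - r * e n 1 - s * e n 0) \<longlonglongrightarrow> 0 - p * 0 - r * 0 - s * 0"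
    by (intro tendsto_diff tendsto_mult tendsto_const y0 e0 e1 e2)
  then show "(\<lambda>n. e n 3) \<longlonglongrightarrow> 0" by simp
qed

text \<open>
  Evenness of the curvature turns the limits of \<open>filtered\<close> at \<open>0, 1, 2, 3\<close> into four linear equations
  (the Yule-Walker equations) for its limits at these points. The limits at larger arguments follow from
  those of \<open>filtered\<close> at negative ones.
\<close>

lemma curvature_tendsto:
  fixes C :: "nat \<Rightarrow> real"
  assumes "C 3 + p * C 2 + r * C 1 + s * C 0 = 0" "C 2 + p * C 1 + r * C 0 + s * C 1 = 0"
    "C 1 + p * C 0 + r * C 1 + s * C 2 = 0" "C 0 + p * C 1 + r * C 2 + s * C 3 = s"
    and C: "\<And>k. C (k + 4) + p * C (k + 3) + r * C (k + 2) + s * C (k + 1) = 0"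
  shows "(\<lambda>n. curvature n (int k)) \<longlonglongrightarrow> C k"
proof -
  define e where "e n k = curvature n (int k) - C k" for n k
  have ev: "curvature n (- 1) = curvature n 1" "curvature n (- 2) = curvature n 2"
    "curvature n (- 3) = curvature n 3" for n by (simp_all add: curvature_even)
  have split: "e n a + p * e n b + r * e n c + s * e n d = (curvature n (int a)
      + p * curvature n (int b) + r * curvature n (int c) + s * curvature n (int d))
      - (C a + p * C b + r * C c + s * C d)" for n a b c d
    by (simp add: e_def algebra_simps)
  have eq: "e n 3 + p * e n 2 + r * e n 1 + s * e n 0 = filtered n 0"
    "e n 2 + p * e n 1 + r * e n 0 + s * e n 1 = filtered n 1"
    "e n 1 + p * e n 0 + r * e n 1 + s * e n 2 = filtered n 2"
    "e n 0 + p * e n 1 + r * e n 2 + s * e n 3 = filtered n 3 - s" for n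
    unfolding split assms(1-4) by (simp_all add: filtered_def ev)
  have y: "(\<lambda>n. e n 3 + p * e n 2 + r * e n 1 + s * e n 0) \<longlonglongrightarrow> 0"
    "(\<lambda>n. e n 2 + p * e n 1 + r * e n 0 + s * e n 1) \<longlonglongrightarrow> 0"
    "(\<lambda>n. e n 1 + p * e n 0 + r * e n 1 + s * e n 2) \<longlonglongrightarrow> 0"
    "(\<lambda>n. e n 0 + p * e n 1 + r * e n 2 + s * e n 3) \<longlonglongrightarrow> 0"
    unfolding eq using tendsto_diff[OF filtered_tendsto_s tendsto_const[of s]]
    by (simp_all add: filtered_tendsto_0)
  note e = yule_walker_null[OF y]
  have "(\<lambda>n. e n k) \<longlonglongrightarrow> 0"
  proof (induction k rule: less_induct)
    case (less k)
    show ?case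
    proof (cases "k < 4")
      case True
      then consider "k = 0" | "k = 1" | "k = 2" | "k = 3" by linarith
      then show ?thesis using e by cases simp_all
    next
      case False
      then have "k = (k - 4) + 4" by simp
      then obtain l where k: "k = l + 4" by blast
      have "(\<lambda>n. filtered n (- int (l + 1)) - p * e n (l + 3) - r * e n (l + 2) - s * e n (l + 1))
          \<longlonglongrightarrow> 0 - p * 0 - r * 0 - s * 0"
        by (intro tendsto_intros filtered_tendsto_0 less.IH) (simp_all add: k)
      moreover have "filtered n (- int (l + 1)) - p * e n (l + 3) - r * e n (l + 2) - s * e n (l + 1) = e n k"
        for n
      proof -
        have "filtered n (- int (l + 1)) = curvature n (int (l + 4)) + p * curvature n (int (l + 3))
            + r * curvature n (int (l + 2)) + s * curvature n (int (l + 1))"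
          unfolding filtered_minus by (simp add: algebra_simps)
        then show ?thesis using C[of l] by (simp add: e_def k algebra_simps)
      qed
      ultimately show ?thesis by simp
    qed
  qed
  then have "(\<lambda>n. e n k + C k) \<longlonglongrightarrow> 0 + C k" by (intro tendsto_intros)
  then show ?thesis by (simp add: e_def)
qed

text \<open>
  Evenness also fixes the initial slope of the potential, so summing the curvature twice recovers it
  without any sum over the whole cycle.
\<close>

lemma potential_tendsto:
  fixes A C :: "nat \<Rightarrow> real"
  assumes C: "\<And>k. (\<lambda>n. curvature n (int k)) \<longlonglongrightarrow> C k"
    and A: "A 0 = 0" "A 1 = C 0 / 2" "\<And>k. A (k + 2) = 2 * A (k + 1) - A k + C (k + 1)"
  shows "(\<lambda>n. potential n (int k)) \<longlonglongrightarrow> A k"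
proof -
  have inv: "(\<lambda>n. 1 / (30 * real n)) \<longlonglongrightarrow> 0"
    using tendsto_mult_left[OF lim_1_over_n, of "1 / 30"] by simp
  have tends: "x \<longlonglongrightarrow> l" if "y \<longlonglongrightarrow> l" and eq: "\<And>n. n > 0 \<Longrightarrow> y n = x n" for x y :: "nat \<Rightarrow> real" and l
  proof (rule Lim_transform_eventually[OF that(1)])
    show "eventually (\<lambda>n. y n = x n) sequentially"
      using eventually_gt_at_top[of 0] by eventually_elim (rule eq)
  qed
  have "(\<lambda>n. potential n (int k)) \<longlonglongrightarrow> A k \<and> (\<lambda>n. potential n (int (k + 1))) \<longlonglongrightarrow> A (k + 1)"
  proof (induction k)
    case 0
    have "(\<lambda>n. potential n 1) \<longlonglongrightarrow> (C 0 - 0) / 2"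
    proof (rule tends)
      show "(\<lambda>n. (curvature n 0 - 1 / (30 * real n)) / 2) \<longlonglongrightarrow> (C 0 - 0) / 2"
        using C[of 0] inv by (intro tendsto_intros) simp_all
      show "(curvature n 0 - 1 / (30 * real n)) / 2 = potential n 1" if n: "n > 0" for n
        using potential_second_difference[OF n, of 0] potential_even[of n 1]
        by (simp add: potential_0)
    qed
    moreover have "(C 0 - 0) / 2 = A 1" unfolding A(2) by simp
    ultimately have "(\<lambda>n. potential n 1) \<longlonglongrightarrow> A 1" by (simp only:)
    then show ?case by (simp add: potential_0 A(1))
  next
    case (Suc k)
    have "(\<lambda>n. potential n (int (k + 2))) \<longlonglongrightarrow> 2 * A (k + 1) - A k + (C (k + 1) - 0)"
    proof (rule tends)
      show "(\<lambda>n. 2 * potential n (int (k + 1)) - potential n (int k)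
          + (curvature n (int (k + 1)) - 1 / (30 * real n)))
          \<longlonglongrightarrow> 2 * A (k + 1) - A k + (C (k + 1) - 0)"
        using Suc.IH by (intro tendsto_intros inv C) auto
      show "2 * potential n (int (k + 1)) - potential n (int k)
          + (curvature n (int (k + 1)) - 1 / (30 * real n)) = potential n (int (k + 2))" if n: "n > 0" for n
        using potential_second_difference[OF n, of "int (k + 1)"] by (simp add: algebra_simps)
    qed
    then show ?case using Suc.IH A(3)[of k] by simp
  qed
  then show ?thesis by simp
qed

end

section \<open>The smallest root\<close>

abbreviation (input) root_polynomial :: "real \<Rightarrow> real" where
  "root_polynomial z \<equiv> z^8 - 4*z^7 - 17*z^6 + 8*z^5 + 49*z^4 + 8*z^3 - 17*z^2 - 4*z + 1"

text \<open>
  For negative \<open>z = -y\<close> the polynomial is a sum of nonnegative terms in \<open>y\<close> and \<open>(y - 1)^2\<close>. Between 0 and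
  \<open>79/500\<close> its terms of degree at most 4 decrease to a positive value, and the sum of the others is nonnegative.
\<close>

lemma root_polynomial_pos:
  assumes "z < 79 / 500" shows "root_polynomial z > 0"
proof (cases "z \<ge> 0")
  case True
  have z: "z \<le> 4 / 25" "z \<le> 1" using assms by simp_all
  define a :: real where "a = 79 / 500"
  have "root_polynomial z = (1 - 4*a - 17*a^2 + 8*a^3 + 49*a^4)
      + (a - z) * (4 + 17 * (z + a) - 8 * (z^2 + a*z + a^2) - 49 * (z^3 + a*z^2 + a^2*z + a^3))
      + z^5 * (8 - 17*z - 4*z^2) + z^8"
    by (simp add: algebra_simps power2_eq_square power3_eq_cube power_numeral_reduce)
  moreover have "0 < 1 - 4*a - 17*a^2 + 8*a^3 + 49*a^4" by (simp add: a_def power_numeral_reduce)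
  moreover have "0 \<le> (a - z) * (4 + 17 * (z + a) - 8 * (z^2 + a*z + a^2) - 49 * (z^3 + a*z^2 + a^2*z + a^3))"
  proof (rule mult_nonneg_nonneg)
    have a: "0 \<le> a" "a \<le> 4 / 25" by (simp_all add: a_def)
    have pw: "z^2 \<le> (4/25)^2" "z^3 \<le> (4/25)^3" "a^2 \<le> (4/25)^2" "a^3 \<le> (4/25)^3"
      using True z a by (intro power_mono; simp)+
    have "a*z \<le> (4/25) * (4/25)" "a*z^2 \<le> (4/25) * (4/25)^2" "a^2*z \<le> (4/25)^2 * (4/25)"
      using True z a pw by (intro mult_mono; simp)+
    with pw show "0 \<le> 4 + 17 * (z + a) - 8 * (z^2 + a*z + a^2) - 49 * (z^3 + a*z^2 + a^2*z + a^3)"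
      using True a by (simp add: power2_eq_square power3_eq_cube)
  qed (use assms in \<open>simp add: a_def\<close>)
  moreover have "0 \<le> z^5 * (8 - 17*z - 4*z^2)"
    using True z power_mono[of z 1 2] by (intro mult_nonneg_nonneg) simp_all
  moreover have "0 \<le> z^8" by simp
  ultimately show ?thesis by linarith
next
  case False
  \<comment> \<open>The polynomial is palindromic: with \<open>v = y + 1/y - 2 = b/y\<close> its value at \<open>-y\<close> is \<open>y^4 * (9 - 24 v + 27 v^2 + 12 v^3 + v^4)\<close>.\<close>
  define y where "y = - z"
  define b where "b = (y - 1)^2"
  have y: "y > 0" and z: "z = - y" using False by (simp_all add: y_def)
  have "root_polynomial z = y^2 * ((3*y - 4*b)^2 + 11*b^2) + 12*y*b^3 + b^4"
    unfolding b_def z by (simp add: algebra_simps power2_eq_square power3_eq_cube power_numeral_reduce)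
  moreover have "0 < y^2 * ((3*y - 4*b)^2 + 11*b^2)"
  proof -
    have "(3*y - 4*b)^2 + 11*b^2 \<noteq> 0"
    proof
      assume "(3*y - 4*b)^2 + 11*b^2 = 0"
      then have "11*b^2 = 0" "(3*y - 4*b)^2 = 0"
        using zero_le_power2[of b] zero_le_power2[of "3*y - 4*b"] by linarith+
      then show False using y by simp
    qed
    moreover have "(3*y - 4*b)^2 + 11*b^2 \<ge> 0" by simp
    ultimately have "(3*y - 4*b)^2 + 11*b^2 > 0" by linarith
    then show ?thesis using y by simp
  qed
  moreover have "0 \<le> 12*y*b^3" "0 \<le> b^4" using y by (simp_all add: b_def)
  ultimately show ?thesis by linarith
qed

lemma smallest_root_bounds:
  assumes root: "root_polynomial \<alpha> = 0"
    and smallest: "\<And>z. root_polynomial z = 0 \<Longrightarrow> \<alpha> \<le> z"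
  shows "79 / 500 \<le> \<alpha>" "\<alpha> \<le> 4 / 25"
proof -
  show "79 / 500 \<le> \<alpha>" using root_polynomial_pos[of \<alpha>] root by linarith
  have "\<exists>x\<ge>0. x \<le> 4 / 25 \<and> root_polynomial x = 0"
    by (rule IVT2') (auto intro!: continuous_intros simp: power_numeral_reduce)
  then show "\<alpha> \<le> 4 / 25" using smallest by force
qed

section \<open>Exact arithmetic with the root\<close>

text \<open>
  Integer polynomials are represented by their lists of coefficients, lowest degree first. The functions
  below compute in the ring of integers with a root of \<open>root_polynomial\<close> adjoined, so that identities
  between values at the root become equations between lists.
\<close>

definition ev :: "real \<Rightarrow> int list \<Rightarrow> real" where
  "ev x cs = horner_sum of_int x cs"

fun add_cs :: "int list \<Rightarrow> int list \<Rightarrow> int list" where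
  "add_cs (a # as) (b # bs) = (a + b) # add_cs as bs"
| "add_cs [] bs = bs"
| "add_cs as [] = as"

definition scale_cs :: "int \<Rightarrow> int list \<Rightarrow> int list" where
  "scale_cs a bs = map ((*) a) bs"

text \<open>
  Multiplication by the root, reducing degree 8 by \<open>root_polynomial\<close> as soon as it occurs.
\<close>

fun times_root :: "int list \<Rightarrow> int list" where
  "times_root [a, b, c, d, e, f, g, h] =
     [- h, a + 4 * h, b + 17 * h, c - 8 * h, d - 49 * h, e - 8 * h, f + 17 * h, g + 4 * h]"
| "times_root bs = 0 # bs"

fun mult_cs :: "int list \<Rightarrow> int list \<Rightarrow> int list" where
  "mult_cs [] bs = []"
| "mult_cs (a # as) bs = add_cs (scale_cs a bs) (times_root (mult_cs as bs))"

lemma ev_simps: "ev x [] = 0" "ev x (a # as) = of_int a + x * ev x as"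
  by (simp_all add: ev_def)

lemma ev_add: "ev x (add_cs as bs) = ev x as + ev x bs"
  by (induction as bs rule: add_cs.induct) (simp_all add: ev_simps algebra_simps)

lemma ev_scale: "ev x (scale_cs a bs) = of_int a * ev x bs"
  by (induction bs) (simp_all add: ev_simps scale_cs_def algebra_simps)

lemma ev_times_root:
  assumes "root_polynomial x = 0"
  shows "ev x (times_root bs) = x * ev x bs"
proof -
  have "x^8 = 4*x^7 + 17*x^6 - 8*x^5 - 49*x^4 - 8*x^3 + 17*x^2 + 4*x - 1" using assms by simp
  then have "of_int h * x^8 = of_int h * (4*x^7 + 17*x^6 - 8*x^5 - 49*x^4 - 8*x^3 + 17*x^2 + 4*x - 1)" for h
    by simp
  then show ?thesis
    by (cases bs rule: times_root.cases)
       (simp_all add: ev_simps algebra_simps power_numeral_reduce power2_eq_square)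
qed

lemma ev_mult:
  assumes "root_polynomial x = 0"
  shows "ev x (mult_cs as bs) = ev x as * ev x bs"
  by (induction as) (simp_all add: ev_simps ev_add ev_scale ev_times_root[OF assms] algebra_simps)

definition sub_cs :: "int list \<Rightarrow> int list \<Rightarrow> int list" where
  "sub_cs as bs = add_cs as (scale_cs (- 1) bs)"

definition minor_cs :: "(nat \<Rightarrow> nat \<Rightarrow> int list) \<Rightarrow> nat \<Rightarrow> nat \<Rightarrow> nat \<Rightarrow> nat \<Rightarrow> int list" where
  "minor_cs A i k j l = sub_cs (mult_cs (A i j) (A k l)) (mult_cs (A i l) (A k j))"

definition det4_cs :: "(nat \<Rightarrow> nat \<Rightarrow> int list) \<Rightarrow> int list" where
  "det4_cs A = (let m = minor_cs A in
     add_cs (sub_cs (add_cs (add_cs (sub_cs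
       (mult_cs (m 0 1 0 1) (m 2 3 2 3))
       (mult_cs (m 0 1 0 2) (m 2 3 1 3)))
       (mult_cs (m 0 1 0 3) (m 2 3 1 2)))
       (mult_cs (m 0 1 1 2) (m 2 3 0 3)))
       (mult_cs (m 0 1 1 3) (m 2 3 0 2)))
       (mult_cs (m 0 1 2 3) (m 2 3 0 1)))"

lemma ev_sub: "ev x (sub_cs as bs) = ev x as - ev x bs"
  by (simp add: sub_cs_def ev_add ev_scale)

lemma ev_det4:
  assumes "root_polynomial x = 0"
  shows "ev x (det4_cs A) = det4 (\<lambda>i j. ev x (A i j))"
  by (simp add: det4_cs_def det4_def minor_cs_def ev_add ev_sub ev_mult[OF assms])

text \<open>
  The limits of the curvature at \<open>0, \<dots>, 7\<close>, times 1350. The first four rows solve the Yule-Walker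
  equations, the others continue the recurrence.
\<close>

definition curvature_cs :: "int list list" where
  "curvature_cs =
    [[224, 608, -60, -2768, -692, 1005, 272, -64],
     [-121, -232, 90, 2272, 568, -870, -238, 56],
     [218, -1144, -1560, 1504, 946, -405, -166, 32],
     [-373, 1784, 4440, -4304, -2786, 1410, 566, -112],
     [-178, 2024, -3210, -10544, -1496, 3885, 926, -232],
     [767, -5536, -1860, 34816, 9844, -12990, -3664, 848],
     [1328, -6424, -10410, -11216, 616, 5595, 1214, -328],
     [-5101, 25208, 52440, -50768, -32642, 15930, 6422, -1264]]"

text \<open>
  The limits of the potential kernel at \<open>0, \<dots>, 8\<close>, times 2700.
\<close>

definition potential_cs :: "int list list" where
  "potential_cs =
    [[0, 0, 0, 0, 0, 0, 0, 0],
     [224, 608, -60, -2768, -692, 1005, 272, -64],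
     [206, 752, 60, -992, -248, 270, 68, -16],
     [624, -1392, -2940, 3792, 2088, -1275, -468, 96],
     [296, 32, 2940, -32, -1148, 0, 128, -16],
     [-388, 5504, 2400, -24944, -7376, 9045, 2576, -592],
     [462, -96, -1860, 19776, 6084, -7890, -2304, 528],
     [3968, -18544, -26940, 42064, 20776, -13635, -4756, 992],
     [-2728, 13424, 52860, -37184, -29816, 12480, 5636, -1072]]"

text \<open>
  The limits of the matrices in \<open>symmetric_det\<close> and \<open>antisymmetric_det\<close>, times 2700 except for the
  column of ones. The index \<open>i - j + (j - i)\<close> is the distance of \<open>i\<close> and \<open>j\<close>, as one of the two
  truncated differences is 0.
\<close>

definition symmetric_cs :: "nat \<Rightarrow> nat \<Rightarrow> int list" where
  "symmetric_cs i j = (if j = 0 then [1] else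
     sub_cs (add_cs [if i = j then 2700 else 0] (add_cs (potential_cs ! (i - j + (j - i))) (potential_cs ! (i + j + 2))))
       (scale_cs 2 (add_cs (potential_cs ! (i + 1)) (potential_cs ! (j + 1)))))"

definition antisymmetric_cs :: "nat \<Rightarrow> nat \<Rightarrow> int list" where
  "antisymmetric_cs i j =
     sub_cs (add_cs [if i = j then 2700 else 0] (potential_cs ! (i - j + (j - i)))) (potential_cs ! (i + j + 2))"

lemma det4_antisymmetric_cs:
  "det4_cs antisymmetric_cs = scale_cs (2700^3 * 4) [780, -1732, -7566, 2004, 3388, -816, -576, 98]"
  by code_simp

lemma det4_symmetric_cs:
  "det4_cs symmetric_cs = scale_cs (2700^2 * 12) [-68, 884, 3470, -1064, -1496, 140, 156, -22]"
  by code_simp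

text \<open>
  The coefficients \<open>p\<close> and \<open>r\<close> of the spectral factor as polynomials in the root, times 75. They result
  from eliminating \<open>r\<close> and \<open>p^2\<close> from the three equations of \<open>spectral_factor\<close> with \<open>s\<close> equal to the
  root.
\<close>

definition p_cs :: "int list" where "p_cs = [152, -616, -675, 2776, 979, -1005, -304, 68]"
definition r_cs :: "int list" where "r_cs = [68, -199, -540, 1219, 556, -435, -151, 32]"

definition p_coeff :: "real \<Rightarrow> real" where "p_coeff x = ev x p_cs / 75"
definition r_coeff :: "real \<Rightarrow> real" where "r_coeff x = ev x r_cs / 75"

fun limit_curvature :: "real \<Rightarrow> nat \<Rightarrow> real" where
  "limit_curvature x 0 = ev x (curvature_cs ! 0) / 1350"
| "limit_curvature x (Suc 0) = ev x (curvature_cs ! 1) / 1350"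
| "limit_curvature x (Suc (Suc 0)) = ev x (curvature_cs ! 2) / 1350"
| "limit_curvature x (Suc (Suc (Suc 0))) = ev x (curvature_cs ! 3) / 1350"
| "limit_curvature x (Suc (Suc (Suc (Suc k)))) =
     - (p_coeff x * limit_curvature x (Suc (Suc (Suc k))) + r_coeff x * limit_curvature x (Suc (Suc k))
        + x * limit_curvature x (Suc k))"

fun limit_potential :: "real \<Rightarrow> nat \<Rightarrow> real" where
  "limit_potential x 0 = 0"
| "limit_potential x (Suc 0) = limit_curvature x 0 / 2"
| "limit_potential x (Suc (Suc k)) =
     2 * limit_potential x (Suc k) - limit_potential x k + limit_curvature x (Suc k)"

definition residual_cs :: "nat \<Rightarrow> nat \<Rightarrow> nat \<Rightarrow> nat \<Rightarrow> int list" where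
  "residual_cs i j k l = add_cs (scale_cs 75 (curvature_cs ! i)) (add_cs (mult_cs p_cs (curvature_cs ! j))
     (add_cs (mult_cs r_cs (curvature_cs ! k)) (scale_cs 75 (mult_cs [0, 1] (curvature_cs ! l)))))"

text \<open>
  The Yule-Walker equations for the tabulated values (the right-hand side of the fourth is
  \<open>1350 * 75\<close> times the root), followed by four steps of the recurrence.
\<close>

lemma residual_cs_eqs:
  "residual_cs 3 2 1 0 = [0, 0, 0, 0, 0, 0, 0, 0]" "residual_cs 2 1 0 1 = [0, 0, 0, 0, 0, 0, 0, 0]"
  "residual_cs 1 0 1 2 = [0, 0, 0, 0, 0, 0, 0, 0]" "residual_cs 0 1 2 3 = [0, 101250, 0, 0, 0, 0, 0, 0]"
  "residual_cs 4 3 2 1 = [0, 0, 0, 0, 0, 0, 0, 0]" "residual_cs 5 4 3 2 = [0, 0, 0, 0, 0, 0, 0, 0]"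
  "residual_cs 6 5 4 3 = [0, 0, 0, 0, 0, 0, 0, 0]" "residual_cs 7 6 5 4 = [0, 0, 0, 0, 0, 0, 0, 0]"
  by code_simp+

lemma coefficient_cs_eqs:
  "add_cs r_cs (mult_cs p_cs [0, 1]) = [0, 225, 0, 0, 0, 0, 0, 0]"
  "add_cs (scale_cs 75 p_cs) (add_cs (mult_cs p_cs r_cs) (scale_cs 75 (mult_cs r_cs [0, 1])))
    = [0, 33750, 0, 0, 0, 0, 0, 0]"
  "add_cs [5625] (add_cs (mult_cs p_cs p_cs) (add_cs (mult_cs r_cs r_cs) (mult_cs [0, 75] [0, 75])))
    = [0, 56250, 0, 0, 0, 0, 0, 0]"
  by code_simp+

lemma potential_cs_step:
  "k < 7 \<Longrightarrow> potential_cs ! (k + 2)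
    = add_cs (sub_cs (scale_cs 2 (potential_cs ! (k + 1))) (potential_cs ! k)) (scale_cs 2 (curvature_cs ! (k + 1)))"
proof -
  have "list_all (\<lambda>k. potential_cs ! (k + 2) = add_cs (sub_cs (scale_cs 2 (potential_cs ! (k + 1)))
      (potential_cs ! k)) (scale_cs 2 (curvature_cs ! (k + 1)))) [0..<7]"
    by code_simp
  then show "k < 7 \<Longrightarrow> ?thesis" by (auto simp: list_all_iff)
qed

lemma BZ_value_cs:
  "mult_cs [780, -1732, -7566, 2004, 3388, -816, -576, 98] [-68, 884, 3470, -1064, -1496, 140, 156, -22]
    = scale_cs 75 [6944, -25304, -87936, -17064, 41056, 16344, -2144, -216]"
  by code_simp

lemma det4_scale:
  "det4 (\<lambda>i j. c j * A i j) = c 0 * c 1 * c 2 * c 3 * det4 A"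
  unfolding det4_def by (simp add: algebra_simps)

lemma det4_cong: "(\<And>i j. i < 4 \<Longrightarrow> j < 4 \<Longrightarrow> A i j = B i j) \<Longrightarrow> det4 A = det4 B"
  by (simp add: det4_def)

section \<open>The limit\<close>

text \<open>
  The bounds distinguish the smallest root from the other real ones. The other roots correspond to
  different choices of one root from each reciprocal pair of the symbol, so they too satisfy the algebraic
  identities but not the limits.
\<close>

locale BZ_root =
  fixes \<alpha> :: real
  assumes root: "root_polynomial \<alpha> = 0"
    and bounds: "79 / 500 \<le> \<alpha>" "\<alpha> \<le> 4 / 25"
begin

lemma power_bounds: "(79 / 500) ^ k \<le> \<alpha> ^ k" "\<alpha> ^ k \<le> (4 / 25) ^ k"
  using bounds by (intro power_mono; simp)+

lemma ev_coeffs: "ev \<alpha> p_cs = 75 * p_coeff \<alpha>" "ev \<alpha> r_cs = 75 * r_coeff \<alpha>"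
  by (simp_all add: p_coeff_def r_coeff_def)

text \<open>
  The root is the constant term of the spectral factor: up to sign the product of the three zeros of the
  symbol in the unit disc.
\<close>

lemma spectral_factor: "spectral_factor (p_coeff \<alpha>) (r_coeff \<alpha>) \<alpha>"
proof
  note eqs = coefficient_cs_eqs[THEN arg_cong[of _ _ "ev \<alpha>"], unfolded ev_add ev_mult[OF root]
      ev_scale ev_coeffs ev_simps]
  show "r_coeff \<alpha> + p_coeff \<alpha> * \<alpha> = 3 * \<alpha>" using eqs(1) by simp
  show "p_coeff \<alpha> + p_coeff \<alpha> * r_coeff \<alpha> + r_coeff \<alpha> * \<alpha> = 6 * \<alpha>" using eqs(2) by simp
  show "1 + p_coeff \<alpha> ^ 2 + r_coeff \<alpha> ^ 2 + \<alpha> ^ 2 = 10 * \<alpha>"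
    using eqs(3) by (simp add: power2_eq_square)
  note pw = power_bounds[of 2] power_bounds[of 3] power_bounds[of 4] power_bounds[of 5]
    power_bounds[of 6] power_bounds[of 7]
  have p: "75 * p_coeff \<alpha> = 152 - 616*\<alpha> - 675*\<alpha>^2 + 2776*\<alpha>^3 + 979*\<alpha>^4 - 1005*\<alpha>^5 - 304*\<alpha>^6 + 68*\<alpha>^7"
    unfolding ev_coeffs[symmetric] p_cs_def ev_simps
    by (simp add: algebra_simps power_numeral_reduce)
  have r: "75 * r_coeff \<alpha> = 68 - 199*\<alpha> - 540*\<alpha>^2 + 1219*\<alpha>^3 + 556*\<alpha>^4 - 435*\<alpha>^5 - 151*\<alpha>^6 + 32*\<alpha>^7"
    unfolding ev_coeffs[symmetric] r_cs_def ev_simps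
    by (simp add: algebra_simps power_numeral_reduce)
  show "63 / 100 \<le> p_coeff \<alpha>" using p pw bounds by (simp add: power_divide)
  show "p_coeff \<alpha> \<le> 18 / 25" using p pw bounds by (simp add: power_divide)
  show "9 / 25 \<le> r_coeff \<alpha>" using r pw bounds by (simp add: power_divide)
  show "r_coeff \<alpha> \<le> 41 / 100" using r pw bounds by (simp add: power_divide)
  show "3 / 20 \<le> \<alpha>" "\<alpha> \<le> 4 / 25" using bounds by simp_all
qed

lemma ev_residual:
  "ev \<alpha> (residual_cs i j k l) = 75 * (ev \<alpha> (curvature_cs ! i) + p_coeff \<alpha> * ev \<alpha> (curvature_cs ! j)
     + r_coeff \<alpha> * ev \<alpha> (curvature_cs ! k) + \<alpha> * ev \<alpha> (curvature_cs ! l))"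
  unfolding residual_cs_def ev_add ev_mult[OF root] ev_scale ev_coeffs by (simp add: ev_simps algebra_simps)

lemma curvature_tendsto: "(\<lambda>n. curvature n (int k)) \<longlonglongrightarrow> limit_curvature \<alpha> k"
proof -
  note eqs = residual_cs_eqs(1-4)[THEN arg_cong[of _ _ "ev \<alpha>"], unfolded ev_residual ev_simps]
  show ?thesis
    by (rule spectral_factor.curvature_tendsto[OF spectral_factor])
       (use eqs in \<open>simp_all add: numeral_eq_Suc[of "num.Bit0 num.One"] eval_nat_numeral field_simps\<close>)
qed

lemma limit_curvature_cs: "k < 8 \<Longrightarrow> limit_curvature \<alpha> k = ev \<alpha> (curvature_cs ! k) / 1350"
proof -
  note eqs = residual_cs_eqs(5-8)[THEN arg_cong[of _ _ "ev \<alpha>"], unfolded ev_residual ev_simps]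
  have C: "limit_curvature \<alpha> 0 = ev \<alpha> (curvature_cs ! 0) / 1350"
    "limit_curvature \<alpha> 1 = ev \<alpha> (curvature_cs ! 1) / 1350"
    "limit_curvature \<alpha> 2 = ev \<alpha> (curvature_cs ! 2) / 1350"
    "limit_curvature \<alpha> 3 = ev \<alpha> (curvature_cs ! 3) / 1350"
    by (simp_all add: eval_nat_numeral)
  have rec: "limit_curvature \<alpha> (k + 4) = - (p_coeff \<alpha> * limit_curvature \<alpha> (k + 3)
      + r_coeff \<alpha> * limit_curvature \<alpha> (k + 2) + \<alpha> * limit_curvature \<alpha> (k + 1))" for k
    by (simp add: eval_nat_numeral)
  have C4: "limit_curvature \<alpha> 4 = ev \<alpha> (curvature_cs ! 4) / 1350"
    using rec[of 0] eqs(1) C by (simp add: field_simps)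
  have C5: "limit_curvature \<alpha> 5 = ev \<alpha> (curvature_cs ! 5) / 1350"
    using rec[of 1] eqs(2) C C4 by (simp add: field_simps)
  have C6: "limit_curvature \<alpha> 6 = ev \<alpha> (curvature_cs ! 6) / 1350"
    using rec[of 2] eqs(3) C C4 C5 by (simp add: field_simps)
  have C7: "limit_curvature \<alpha> 7 = ev \<alpha> (curvature_cs ! 7) / 1350"
    using rec[of 3] eqs(4) C C4 C5 C6 by (simp add: field_simps)
  show "limit_curvature \<alpha> k = ev \<alpha> (curvature_cs ! k) / 1350" if "k < 8"
  proof -
    from that have "k \<in> {0, 1, 2, 3, 4, 5, 6, 7}" by auto
    then show ?thesis using C C4 C5 C6 C7 by blast
  qed
qed

lemma limit_potential_cs: "k < 9 \<Longrightarrow> limit_potential \<alpha> k = ev \<alpha> (potential_cs ! k) / 2700"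
proof (induction k rule: less_induct)
  case (less k)
  consider "k = 0" | "k = 1" | l where "k = l + 2"
    by (metis One_nat_def add_2_eq_Suc' old.nat.exhaust)
  then show ?case
  proof cases
    case 1
    then show ?thesis by (simp add: potential_cs_def ev_simps)
  next
    case 2
    then show ?thesis by (simp add: potential_cs_def curvature_cs_def)
  next
    case (3 l)
    have "limit_potential \<alpha> (l + 2) = 2 * limit_potential \<alpha> (l + 1) - limit_potential \<alpha> l
        + limit_curvature \<alpha> (l + 1)" by simp
    moreover have "ev \<alpha> (potential_cs ! (l + 2)) = 2 * ev \<alpha> (potential_cs ! (l + 1))
        - ev \<alpha> (potential_cs ! l) + 2 * ev \<alpha> (curvature_cs ! (l + 1))"
      using potential_cs_step[of l] less.prems 3 by (simp add: ev_add ev_sub ev_scale)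
    ultimately show ?thesis
      using less.IH[of "l + 1"] less.IH[of l] limit_curvature_cs[of "l + 1"] less.prems 3
      by (simp add: field_simps)
  qed
qed

lemma potential_tendsto: "(\<lambda>n. potential n k) \<longlonglongrightarrow> limit_potential \<alpha> (nat \<bar>k\<bar>)"
proof -
  have "(\<lambda>n. potential n (int m)) \<longlonglongrightarrow> limit_potential \<alpha> m" for m
    by (rule spectral_factor.potential_tendsto[OF spectral_factor curvature_tendsto]) simp_all
  from this[of "nat \<bar>k\<bar>"] show ?thesis
    using potential_even[of _ k] by (cases "k \<ge> 0") simp_all
qed

definition limit_g :: "int \<Rightarrow> int \<Rightarrow> real" where
  "limit_g k l = limit_potential \<alpha> (nat \<bar>k\<bar>) + limit_potential \<alpha> (nat \<bar>l\<bar>)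
     - limit_potential \<alpha> (nat \<bar>k - l\<bar>)"

lemma BZ_ratio_tendsto:
  "BZ_ratio (\<lambda>n. graph_power (cycle_graph n) 4) \<longlonglongrightarrow>
    det4 (\<lambda>i j. if j = 0 then 1 else
      of_bool (i = j) - (limit_g (int i + 1) (int j + 1) + limit_g (int i + 1) (- (int j + 1))))
    * det4 (\<lambda>i j.
      of_bool (i = j) - (limit_g (int i + 1) (int j + 1) - limit_g (int i + 1) (- (int j + 1))))"
    (is "_ \<longlonglongrightarrow> det4 ?S * det4 ?A")
proof (rule Lim_transform_eventually)
  let ?g = "\<lambda>n k l. potential n k + potential n l - potential n (k - l)"
  let ?Sn = "\<lambda>n i j. if j = 0 then 1 else
      of_bool (i = j) - (?g n (int i + 1) (int j + 1) + ?g n (int i + 1) (- (int j + 1)))"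
  let ?An = "\<lambda>n i j.
      of_bool (i = j) - (?g n (int i + 1) (int j + 1) - ?g n (int i + 1) (- (int j + 1)))"
  have g: "(\<lambda>n. ?g n k l) \<longlonglongrightarrow> limit_g k l" for k l
    unfolding limit_g_def by (intro tendsto_add tendsto_diff potential_tendsto)
  show "(\<lambda>n. det4 (?Sn n) * det4 (?An n)) \<longlonglongrightarrow> det4 ?S * det4 ?A"
  proof (intro tendsto_mult tendsto_det4)
    show "(\<lambda>n. ?Sn n i j) \<longlonglongrightarrow> ?S i j" for i j
      by (cases "j = 0") (simp_all only: simp_thms if_True if_False tendsto_const
          tendsto_diff[OF tendsto_const tendsto_add[OF g g]])
    show "(\<lambda>n. ?An n i j) \<longlonglongrightarrow> ?A i j" for i j
      by (intro tendsto_diff tendsto_const g)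
  qed
  show "eventually (\<lambda>n. det4 (?Sn n) * det4 (?An n)
      = BZ_ratio (\<lambda>n. graph_power (cycle_graph n) 4) n) sequentially"
    using eventually_ge_at_top[of 9]
  proof eventually_elim
    case (elim n)
    note n = cycle_green_potential[OF elim]
    show ?case
      unfolding cycle_green.BZ_ratio_eq[OF n] cycle_green.symmetric_det_def[OF n]
        cycle_green.antisymmetric_det_def[OF n] cycle_green.green_def[OF n] ..
  qed
qed

lemma limit_g_cs:
  assumes "i < 4" "j < 4"
  shows "2700 * limit_g (int i + 1) (int j + 1) = ev \<alpha> (potential_cs ! (i + 1))
      + ev \<alpha> (potential_cs ! (j + 1)) - ev \<alpha> (potential_cs ! (i - j + (j - i)))"
    "2700 * limit_g (int i + 1) (- (int j + 1)) = ev \<alpha> (potential_cs ! (i + 1))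
      + ev \<alpha> (potential_cs ! (j + 1)) - ev \<alpha> (potential_cs ! (i + j + 2))"
proof -
  have index: "nat \<bar>int i + 1\<bar> = i + 1" "nat \<bar>int j + 1\<bar> = j + 1" "nat \<bar>- (int j + 1)\<bar> = j + 1"
    "nat \<bar>int i + 1 - (int j + 1)\<bar> = i - j + (j - i)" "nat \<bar>int i + 1 - - (int j + 1)\<bar> = i + j + 2"
    by linarith+
  have less: "i + 1 < 9" "j + 1 < 9" "i - j + (j - i) < 9" "i + j + 2 < 9" using assms by linarith+
  note lp = less[THEN limit_potential_cs]
  show "2700 * limit_g (int i + 1) (int j + 1) = ev \<alpha> (potential_cs ! (i + 1))
      + ev \<alpha> (potential_cs ! (j + 1)) - ev \<alpha> (potential_cs ! (i - j + (j - i)))"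
    unfolding limit_g_def index lp by simp
  show "2700 * limit_g (int i + 1) (- (int j + 1)) = ev \<alpha> (potential_cs ! (i + 1))
      + ev \<alpha> (potential_cs ! (j + 1)) - ev \<alpha> (potential_cs ! (i + j + 2))"
    unfolding limit_g_def index lp by simp
qed

lemma limit_determinants:
  "225 * det4 (\<lambda>i j. if j = 0 then 1 else
      of_bool (i = j) - (limit_g (int i + 1) (int j + 1) + limit_g (int i + 1) (- (int j + 1))))
    = ev \<alpha> [-68, 884, 3470, -1064, -1496, 140, 156, -22]" (is "225 * det4 ?S = ?s")
  "675 * det4 (\<lambda>i j.
      of_bool (i = j) - (limit_g (int i + 1) (int j + 1) - limit_g (int i + 1) (- (int j + 1))))
    = ev \<alpha> [780, -1732, -7566, 2004, 3388, -816, -576, 98]" (is "675 * det4 ?A = ?a")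
proof -
  let ?c = "\<lambda>j :: nat. if j = 0 then 1 else 2700 :: real"
  have "det4 (\<lambda>i j. ?c j * ?S i j) = det4 (\<lambda>i j. ev \<alpha> (symmetric_cs i j))"
  proof (rule det4_cong)
    fix i j :: nat assume "i < 4" "j < 4"
    note g = limit_g_cs[OF this]
    have scale: "2700 * (b - (x + y)) = 2700 * b - (2700 * x + 2700 * y)" for b x y :: real
      by (simp add: algebra_simps)
    show "?c j * ?S i j = ev \<alpha> (symmetric_cs i j)"
    proof (cases "j = 0")
      case False
      then show ?thesis unfolding symmetric_cs_def
        by (simp only: if_False scale g ev_add ev_sub ev_scale) (simp add: ev_simps)
    qed (simp add: symmetric_cs_def ev_simps)
  qed
  then have "2700 ^ 3 * det4 ?S = ev \<alpha> (det4_cs symmetric_cs)"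
    unfolding det4_scale[of ?c ?S] ev_det4[OF root] by simp
  then show "225 * det4 ?S = ?s" unfolding det4_symmetric_cs ev_scale by simp
  have "det4 (\<lambda>i j. 2700 * ?A i j) = det4 (\<lambda>i j. ev \<alpha> (antisymmetric_cs i j))"
  proof (rule det4_cong)
    fix i j :: nat assume "i < 4" "j < 4"
    note g = limit_g_cs[OF this]
    have scale: "2700 * (b - (x - y)) = 2700 * b - (2700 * x - 2700 * y)" for b x y :: real
      by (simp add: algebra_simps)
    show "2700 * ?A i j = ev \<alpha> (antisymmetric_cs i j)" unfolding antisymmetric_cs_def
      by (simp only: scale g ev_add ev_sub ev_scale) (simp add: ev_simps)
  qed
  then have "2700 ^ 4 * det4 ?A = ev \<alpha> (det4_cs antisymmetric_cs)"
    unfolding det4_scale[of "\<lambda>_. 2700" ?A] ev_det4[OF root] by simp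
  then show "675 * det4 ?A = ?a" unfolding det4_antisymmetric_cs ev_scale by simp
qed

lemma BZ_ratio_limit:
  "BZ_ratio (\<lambda>n. graph_power (cycle_graph n) 4) \<longlonglongrightarrow>
    ev \<alpha> [6944, -25304, -87936, -17064, 41056, 16344, -2144, -216] / 2025"
proof -
  have scale: "y * x = z / 2025" if "(675 * x) * (225 * y) = 75 * z" for x y z :: real
    using that by (simp add: field_simps)
  have "ev \<alpha> [780, -1732, -7566, 2004, 3388, -816, -576, 98]
      * ev \<alpha> [-68, 884, 3470, -1064, -1496, 140, 156, -22]
      = 75 * ev \<alpha> [6944, -25304, -87936, -17064, 41056, 16344, -2144, -216]"
    using BZ_value_cs[THEN arg_cong[of _ _ "ev \<alpha>"]] unfolding ev_mult[OF root] ev_scale by simp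
  note value_eq = scale[OF this[folded limit_determinants]]
  show ?thesis using BZ_ratio_tendsto unfolding value_eq .
qed

end

theorem theorem5p3p3:
  fixes \<alpha> :: real
  assumes root: "\<alpha>^8 - 4*\<alpha>^7 - 17*\<alpha>^6 + 8*\<alpha>^5 + 49*\<alpha>^4 + 8*\<alpha>^3 - 17*\<alpha>^2 - 4*\<alpha> + 1 = 0"
    and smallest: "\<And>z::real. z^8 - 4*z^7 - 17*z^6 + 8*z^5 + 49*z^4 + 8*z^3 - 17*z^2 - 4*z + 1 = 0
                    \<Longrightarrow> \<alpha> \<le> z"
  shows "convergent (BZ_ratio (\<lambda>n. graph_power (cycle_graph n) 4)) \<and>
         BZ (\<lambda>n. graph_power (cycle_graph n) 4) =
           1 / 2025 * (- 216*\<alpha>^7 - 2144*\<alpha>^6 + 16344*\<alpha>^5 + 41056*\<alpha>^4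
                       - 17064*\<alpha>^3 - 87936*\<alpha>^2 - 25304*\<alpha> + 6944)"
proof -
  interpret BZ_root \<alpha>
    by unfold_locales (use root smallest_root_bounds[OF root smallest] in simp_all)
  have "ev \<alpha> [6944, -25304, -87936, -17064, 41056, 16344, -2144, -216]
      = - 216*\<alpha>^7 - 2144*\<alpha>^6 + 16344*\<alpha>^5 + 41056*\<alpha>^4
        - 17064*\<alpha>^3 - 87936*\<alpha>^2 - 25304*\<alpha> + 6944"
    by (simp add: ev_simps algebra_simps power_numeral_reduce)
  with BZ_ratio_limit show ?thesis
    unfolding BZ_def using limI[OF BZ_ratio_limit] by (auto simp: convergent_def)
qed

end
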